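(* Set $m=\pm\sqrt{\varepsilon}$. There exist a value $\varepsilon_0>0$ and a function $a=\tilde a(k,\varepsilon;m)$, analytic as a function of $(k,\sqrt{\varepsilon})$, defined in the open set $U=(0,+\infty)\times(0,\varepsilon_0)$, such that for $(k,\varepsilon)\in U$ a solution of the system $$x'=y-f(x,a,k,m,\varepsilon),\qquad y'=\varepsilon(a-x)$$ starting in the attracting branch $\mu_R$ of the slow manifold connects to the repelling branch $\mu_L$ of the slow manifold if and only if $a=\tilde a(k,\varepsilon;m)$. In such case, the time of flight of the transition is $\tau_C(k,\varepsilon;m)>0$. The first terms of the expansions of $\tilde a$ and $\tau_C$ are $$\tilde a(k,\varepsilon;m)=\begin{cases}\dfrac{e^{\pi/\sqrt3}-1}{e^{\pi/\sqrt3}+1}\sqrt{\varepsilon}-\dfrac{e^{\pi/\sqrt3}}{(e^{\pi/\sqrt3}+1)^2}\left(\dfrac{1-k^2}{k^2}\right)\varepsilon^{3/2}+O(\varepsilon^2), & m=-\sqrt{\varepsilon},\\[2mm] -\dfrac{e^{\pi/\sqrt3}-1}{e^{\pi/\sqrt3}+1}\sqrt{\varepsilon}-\dfrac{e^{\pi/\sqrt3}}{(e^{\pi/\sqrt3}+1)^2}\left(\dfrac{1-k^2}{k^2}\right)\varepsilon^{3/2}+O(\varepsilon^2), & m=\sqrt{\varepsilon},\end{cases}$$ and $$\tau_C(k,\varepsilon;m)=\begin{cases}\dfrac{2\pi}{\sqrt3}\dfrac1{\sqrt{\varepsilon}}-\dfrac{1+k}{k}-\dfrac{1-k^2}{2k^2}\sqrt{\varepsilon}+O(\varepsilon),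 & m=-\sqrt{\varepsilon},\\[2mm] \dfrac{2\pi}{\sqrt3}\dfrac1{\sqrt{\varepsilon}}-\dfrac{1+k}{k}+\dfrac{1-k^2}{2k^2}\sqrt{\varepsilon}+O(\varepsilon), & m=\sqrt{\varepsilon}.\end{cases}$$
   Context: Parameters: $a\in\mathbb{R}$, $k>0$, $|m|<2\sqrt{\varepsilon}$, $0<\varepsilon\ll1$. The continuous piecewise linear function $f$ is $$f(x,a,k,m,\varepsilon)=\begin{cases}x+1-k(\sqrt{\varepsilon}-1)-m(\sqrt{\varepsilon}+a), & x<-1,\\ -k(x+\sqrt{\varepsilon})-m(\sqrt{\varepsilon}+a), & -1\le x\le-\sqrt{\varepsilon},\\ m(x-a), & |x|\le\sqrt{\varepsilon},\\ x-\sqrt{\varepsilon}+m(\sqrt{\varepsilon}-a), & x>\sqrt{\varepsilon}.\end{cases}$$ Eigenvalues of the linear systems: for $-1\le x\le-\sqrt{\varepsilon}$, $\lambda_L^s=\frac{k-\sqrt{k^2-4\varepsilon}}2$ (slow); for $x\ge\sqrt{\varepsilon}$, $\lambda_R^s=\frac{-1+\sqrt{1-4\varepsilon}}2$ (slow). Slow eigenvectors: $\mathbf v_i^s=(\lambda_i^s,-\varepsilon)^T$, $i\in\{L,R\}$. Put $\mathbf e_L=(a,-(m+k)(\sqrt{\varepsilon}+a))^T$ and $\mathbf e_R=(a,(m-1)(\sqrt{\varepsilon}-a))^T$. The branches of the slow manifold are $$\mu_L=\left\{\mathbf e_L-r\mathbf v_L^s:\ r\in\left[\tfrac{\sqrt{\varepsilon}+a}{\lambda_L^s},\tfrac{1+a}{\lambda_L^s}\right]\right\},\qquad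 \mu_R=\left\{\mathbf e_R-r\mathbf v_R^s:\ r\in\left[\tfrac{a-\sqrt{\varepsilon}}{\lambda_R^s},+\infty\right)\right\}.$$ $\mu_R$ meets the line $x=\sqrt{\varepsilon}$ at $\mathbf q_1^R=(\sqrt{\varepsilon},(m+\lambda_R^s)(\sqrt{\varepsilon}-a))^T$ and $\mu_L$ meets the line $x=-\sqrt{\varepsilon}$ at $\mathbf q_0^L=(-\sqrt{\varepsilon},-(m+\lambda_L^s)(\sqrt{\varepsilon}+a))^T$. The connection ("maximal canard") is an orbit going from $\mathbf q_1^R$ to $\mathbf q_0^L$ through the central band $|x|<\sqrt{\varepsilon}$, and the time of flight of the transition is the time needed to go from $\mathbf q_1^R$ to $\mathbf q_0^L$.
   Formalization: The set U is restricted to the points with 4ε < k², since for k² < 4ε the eigenvalue λ_L^s is not real and the branch μ_L is undefined (and ã is not analytic across k² = 4ε). *)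

theory Defs
  imports "HOL-Analysis.Analysis" "HOL-Library.Landau_Symbols"
begin

definition pwl_f :: "real \<Rightarrow> real \<Rightarrow> real \<Rightarrow> real \<Rightarrow> real \<Rightarrow> real" where
  "pwl_f x a k m \<epsilon> =
     (if x < -1 then x + 1 - k * (sqrt \<epsilon> - 1) - m * (sqrt \<epsilon> + a)
      else if x \<le> - sqrt \<epsilon> then - k * (x + sqrt \<epsilon>) - m * (sqrt \<epsilon> + a)
      else if x \<le> sqrt \<epsilon> then m * (x - a)
      else x - sqrt \<epsilon> + m * (sqrt \<epsilon> - a))"

text \<open>Solutions on an interval; at the endpoints of \<open>I\<close> the derivatives are one-sided.\<close>

definition pwl_solution ::
  "real \<Rightarrow> real \<Rightarrow> real \<Rightarrow> real \<Rightarrow> (real \<Rightarrow> real \<times> real) \<Rightarrow> real set \<Rightarrow> bool" where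
  "pwl_solution a k m \<epsilon> z I \<longleftrightarrow>
     (\<forall>t\<in>I. ((\<lambda>t. fst (z t)) has_real_derivative
                 snd (z t) - pwl_f (fst (z t)) a k m \<epsilon>) (at t within I) \<and>
             ((\<lambda>t. snd (z t)) has_real_derivative
                 \<epsilon> * (a - fst (z t))) (at t within I))"

definition lambda_L :: "real \<Rightarrow> real \<Rightarrow> real" where
  "lambda_L k \<epsilon> = (k - sqrt (k\<^sup>2 - 4 * \<epsilon>)) / 2"

definition lambda_R :: "real \<Rightarrow> real" where
  "lambda_R \<epsilon> = (- 1 + sqrt (1 - 4 * \<epsilon>)) / 2"

definition v_L :: "real \<Rightarrow> real \<Rightarrow> real \<times> real" where
  "v_L k \<epsilon> = (lambda_L k \<epsilon>, - \<epsilon>)"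

definition v_R :: "real \<Rightarrow> real \<times> real" where
  "v_R \<epsilon> = (lambda_R \<epsilon>, - \<epsilon>)"

definition e_L :: "real \<Rightarrow> real \<Rightarrow> real \<Rightarrow> real \<Rightarrow> real \<times> real" where
  "e_L a k m \<epsilon> = (a, - (m + k) * (sqrt \<epsilon> + a))"

definition e_R :: "real \<Rightarrow> real \<Rightarrow> real \<Rightarrow> real \<times> real" where
  "e_R a m \<epsilon> = (a, (m - 1) * (sqrt \<epsilon> - a))"

definition mu_L :: "real \<Rightarrow> real \<Rightarrow> real \<Rightarrow> real \<Rightarrow> (real \<times> real) set" where
  "mu_L a k m \<epsilon> =
     (\<lambda>r. e_L a k m \<epsilon> - r *\<^sub>R v_L k \<epsilon>) `
       {(sqrt \<epsilon> + a) / lambda_L k \<epsilon> .. (1 + a) / lambda_L k \<epsilon>}"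

definition mu_R :: "real \<Rightarrow> real \<Rightarrow> real \<Rightarrow> (real \<times> real) set" where
  "mu_R a m \<epsilon> =
     (\<lambda>r. e_R a m \<epsilon> - r *\<^sub>R v_R \<epsilon>) ` {(a - sqrt \<epsilon>) / lambda_R \<epsilon> ..}"

definition q1_R :: "real \<Rightarrow> real \<Rightarrow> real \<Rightarrow> real \<times> real" where
  "q1_R a m \<epsilon> = (sqrt \<epsilon>, (m + lambda_R \<epsilon>) * (sqrt \<epsilon> - a))"

definition q0_L :: "real \<Rightarrow> real \<Rightarrow> real \<Rightarrow> real \<Rightarrow> real \<times> real" where
  "q0_L a k m \<epsilon> = (- sqrt \<epsilon>, - (m + lambda_L k \<epsilon>) * (sqrt \<epsilon> + a))"

lemma mu_R_inter_right_line:
  assumes "0 < \<epsilon>" "4 * \<epsilon> \<le> 1"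
  shows "mu_R a m \<epsilon> \<inter> {p. fst p = sqrt \<epsilon>} = {q1_R a m \<epsilon>}"
proof -
  define l where "l = lambda_R \<epsilon>"
  have l: "l * (l + 1) = - \<epsilon>"
    using assms real_sqrt_pow2[of "1 - 4 * \<epsilon>"]
    unfolding l_def lambda_R_def by (simp add: field_simps power2_eq_square)
  then have l0: "l \<noteq> 0" using assms by auto
  have pt: "e_R a m \<epsilon> - ((a - sqrt \<epsilon>) / l) *\<^sub>R v_R \<epsilon> = q1_R a m \<epsilon>"
  proof -
    have "\<epsilon> = - l * (l + 1)" using l by simp
    then have "(a - sqrt \<epsilon>) / l * \<epsilon> = - (a - sqrt \<epsilon>) * (l + 1)"
      using l0 by (metis (no_types, opaque_lifting) minus_mult_commute mult.assoc nonzero_divide_eq_eq)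
    moreover have "(a - sqrt \<epsilon>) / l * l = a - sqrt \<epsilon>" using l0 by simp
    ultimately show ?thesis
      unfolding e_R_def v_R_def q1_R_def l_def[symmetric]
      by (simp only: scaleR_Pair diff_Pair real_scaleR_def mult_minus_right) (simp add: algebra_simps)
  qed
  have uniq: "r = (a - sqrt \<epsilon>) / l" if "fst (e_R a m \<epsilon> - r *\<^sub>R v_R \<epsilon>) = sqrt \<epsilon>" for r
    using that l0 unfolding e_R_def v_R_def l_def[symmetric] by (simp add: field_simps)
  have fst_q: "fst (q1_R a m \<epsilon>) = sqrt \<epsilon>" by (simp add: q1_R_def)
  have "q1_R a m \<epsilon> \<in> mu_R a m \<epsilon>"
    unfolding mu_R_def l_def[symmetric] using order_refl
    by (intro image_eqI[where x = "(a - sqrt \<epsilon>) / l"]) (simp_all add: pt)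
  moreover have "w = q1_R a m \<epsilon>" if "w \<in> mu_R a m \<epsilon>" "fst w = sqrt \<epsilon>" for w
    using that pt uniq unfolding mu_R_def l_def[symmetric] by blast
  ultimately show ?thesis using fst_q by blast
qed

lemma mu_L_inter_left_line:
  assumes "0 < \<epsilon>" "\<epsilon> \<le> 1" "0 < k" "4 * \<epsilon> \<le> k\<^sup>2"
  shows "mu_L a k m \<epsilon> \<inter> {p. fst p = - sqrt \<epsilon>} = {q0_L a k m \<epsilon>}"
proof -
  define l where "l = lambda_L k \<epsilon>"
  have l: "l * (k - l) = \<epsilon>"
    using assms real_sqrt_pow2[of "k\<^sup>2 - 4 * \<epsilon>"]
    unfolding l_def lambda_L_def by (simp add: field_simps power2_eq_square)
  have "sqrt (k\<^sup>2 - 4 * \<epsilon>) < sqrt (k\<^sup>2)" using assms by (intro real_sqrt_less_mono) auto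
  then have l0: "l > 0" using assms unfolding l_def lambda_L_def by simp
  have pt: "e_L a k m \<epsilon> - ((sqrt \<epsilon> + a) / l) *\<^sub>R v_L k \<epsilon> = q0_L a k m \<epsilon>"
  proof -
    have "(sqrt \<epsilon> + a) / l * \<epsilon> = (sqrt \<epsilon> + a) * (k - l)"
      using l0 by (simp add: l[symmetric])
    moreover have "(sqrt \<epsilon> + a) / l * l = sqrt \<epsilon> + a" using l0 by simp
    ultimately show ?thesis
      unfolding e_L_def v_L_def q0_L_def l_def[symmetric]
      by (simp only: scaleR_Pair diff_Pair real_scaleR_def mult_minus_right) (simp add: algebra_simps)
  qed
  have uniq: "r = (sqrt \<epsilon> + a) / l" if "fst (e_L a k m \<epsilon> - r *\<^sub>R v_L k \<epsilon>) = - sqrt \<epsilon>" for r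
    using that l0 unfolding e_L_def v_L_def l_def[symmetric] by (simp add: field_simps)
  have ne: "(sqrt \<epsilon> + a) / l \<le> (1 + a) / l"
    using assms l0 by (intro divide_right_mono) auto
  have fst_q: "fst (q0_L a k m \<epsilon>) = - sqrt \<epsilon>" by (simp add: q0_L_def)
  have "q0_L a k m \<epsilon> \<in> mu_L a k m \<epsilon>"
    unfolding mu_L_def l_def[symmetric] using ne
    by (intro image_eqI[where x = "(sqrt \<epsilon> + a) / l"]) (simp_all add: pt)
  moreover have "w = q0_L a k m \<epsilon>" if "w \<in> mu_L a k m \<epsilon>" "fst w = - sqrt \<epsilon>" for w
    using that pt uniq unfolding mu_L_def l_def[symmetric] by blast
  ultimately show ?thesis using fst_q by blast
qed

text \<open>
  The maximal canard through \<open>p \<in> mu_R\<close>: an orbit from \<open>p\<close> that passes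
  from \<open>q1_R\<close> to \<open>q0_L\<close> through the open central band, where it reaches
  \<open>mu_L\<close>.  The time of flight \<open>\<tau>\<close> is the time spent between these two points;
  \<open>t0\<close> is the time needed to go from \<open>p\<close> to \<open>q1_R\<close>.
\<close>

definition connects_from ::
  "real \<Rightarrow> real \<Rightarrow> real \<Rightarrow> real \<Rightarrow> real \<times> real \<Rightarrow> real \<Rightarrow> bool" where
  "connects_from a k m \<epsilon> p \<tau> \<longleftrightarrow>
     0 < \<tau> \<and> p \<in> mu_R a m \<epsilon> \<and>
     (\<exists>z t0. 0 \<le> t0 \<and> pwl_solution a k m \<epsilon> z {0 .. t0 + \<tau>} \<and>
        z 0 = p \<and> z t0 = q1_R a m \<epsilon> \<and>
        (\<forall>t\<in>{t0<..<t0 + \<tau>}. \<bar>fst (z t)\<bar> < sqrt \<epsilon>) \<and>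
        z (t0 + \<tau>) = q0_L a k m \<epsilon> \<and> z (t0 + \<tau>) \<in> mu_L a k m \<epsilon>)"

text \<open>Real analyticity in two variables: local expansion in an unconditionally convergent
  double power series.\<close>

definition real_analytic2_on :: "(real \<times> real \<Rightarrow> real) \<Rightarrow> (real \<times> real) set \<Rightarrow> bool" where
  "real_analytic2_on F S \<longleftrightarrow>
     (\<forall>(u, v)\<in>S. \<exists>(c :: nat \<times> nat \<Rightarrow> real) r. 0 < r \<and>
        (\<forall>x y. \<bar>x - u\<bar> < r \<longrightarrow> \<bar>y - v\<bar> < r \<longrightarrow>
           ((\<lambda>(i, j). c (i, j) * (x - u) ^ i * (y - v) ^ j) has_sum F (x, y)) UNIV))"

text \<open>
  The parameter set \<open>{0<..} \<times> {0<..<\<epsilon>0}\<close>, intersected with the open region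
  \<open>4 * \<epsilon> < k\<^sup>2\<close> in which the eigenvalues of the left zone are real and distinct.
  This condition is part of the requirement that \<open>\<epsilon>\<close> be small.  Without it \<open>lambda_L\<close>
  and the repelling branch \<open>mu_L\<close> do not exist (note that \<open>sqrt\<close> of a negative real
  is not an error in HOL).
\<close>

definition param_dom :: "real \<Rightarrow> (real \<times> real) set" where
  "param_dom \<epsilon>0 = {(k, \<epsilon>). 0 < k \<and> 0 < \<epsilon> \<and> \<epsilon> < \<epsilon>0 \<and> 4 * \<epsilon> < k\<^sup>2}"

end

theory Submission
  imports Defs "HOL-Complex_Analysis.Complex_Analysis" "HOL-Real_Asymp.Real_Asymp"
begin

text \<open>
  With \<open>s = sqrt \<epsilon>\<close>, \<open>m = \<sigma> * s\<close> and rescaled time \<open>T = s * t\<close>, the flow in the central band is the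
  linear oscillator \<open>u'' + \<sigma> * u' + u = 0\<close> for \<open>u = x - a\<close>, independently of \<open>a\<close> and \<open>k\<close>.  The point
  \<open>q1_R\<close> lies on the ray \<open>u' = \<rho> * u\<close> with \<open>\<rho> = lambda_R \<epsilon> / s < 0\<close>, and \<open>q0_L\<close> on the ray \<open>u' = l * u\<close>
  with \<open>l = lambda_L k \<epsilon> / s > 0\<close>.  Hence the flight time is the time in which the spiral turns from one
  ray to the other, and \<open>(s + a) / (s - a)\<close> must be the contraction ratio \<open>R\<close> over that time, so
  \<open>a = s * (R - 1) / (R + 1)\<close>.  A further full turn would leave the band: forwards if the spiral
  expands (\<open>\<sigma> = -1\<close>), backwards if it contracts (\<open>\<sigma> = 1\<close>).  Both quantities are explicit in
  \<open>arctan\<close>, \<open>exp\<close> and \<open>sqrt\<close>.  Their expansions follow since, up to additive constants, the rescaled flight time and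
  \<open>ln R\<close> are the integrals of \<open>1 / (1 + \<sigma> * x + x\<^sup>2)\<close> and \<open>x / (1 + \<sigma> * x + x\<^sup>2)\<close> from \<open>l\<close> to \<open>\<rho>\<close>.
  Analyticity in two variables is obtained from a separately holomorphic continuous extension.
\<close>

section \<open>Analytic functions of two variables\<close>

text \<open>Once the first \<open>i\<close> terms are removed and the rest is divided by
  \<open>h ^ i\<close>, the series starts with \<open>c i\<close>, and what follows is dominated by
  a geometric series of ratio \<open>norm h / r\<close>. The bound depends on the coefficients only
  through \<open>M\<close> and \<open>r\<close>, hence is uniform over a family of series.\<close>

lemma power_series_tail_bound:
  fixes c :: "nat \<Rightarrow> complex"
  assumes sums: "(\<lambda>j. c j * h ^ j) sums g" and bd: "\<And>j. norm (c j) \<le> M / r ^ j"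
    and h: "h \<noteq> 0" "norm h \<le> r / 2" and r: "0 < r"
  shows "norm ((g - (\<Sum>j<i. c j * h ^ j)) / h ^ i - c i) \<le> 2 * M * norm h / r ^ Suc i"
proof -
  define \<theta> where "\<theta> = norm h / r"
  have \<theta>: "0 \<le> \<theta>" "\<theta> \<le> 1/2" unfolding \<theta>_def using h r by (auto simp: field_simps)
  have M: "0 \<le> M" using order_trans[OF norm_ge_zero bd[of 0]] by simp
  have "(\<lambda>j. c (j + i) * h ^ (j + i)) sums (g - (\<Sum>j<i. c j * h ^ j))"
    using sums by (rule sums_split_initial_segment)
  then have "(\<lambda>j. c (j + i) * h ^ (j + i) / h ^ i) sums ((g - (\<Sum>j<i. c j * h ^ j)) / h ^ i)"
    by (rule sums_divide)
  then have "(\<lambda>j. c (j + i) * h ^ j) sums ((g - (\<Sum>j<i. c j * h ^ j)) / h ^ i)"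
    using h by (simp add: power_add)
  from sums_split_initial_segment[OF this, of 1]
  have s: "(\<lambda>j. c (Suc j + i) * h ^ Suc j) sums ((g - (\<Sum>j<i. c j * h ^ j)) / h ^ i - c i)"
    by simp
  have le: "norm (c (Suc j + i) * h ^ Suc j) \<le> M / r ^ i * \<theta> * \<theta> ^ j" for j
  proof -
    have "norm (c (Suc j + i) * h ^ Suc j) \<le> M / r ^ (Suc j + i) * norm h ^ Suc j"
      unfolding norm_mult norm_power by (intro mult_right_mono bd) auto
    also have "\<dots> = M / r ^ i * \<theta> * \<theta> ^ j"
      unfolding \<theta>_def using r by (simp add: power_add power_divide mult_ac)
    finally show ?thesis .
  qed
  have g: "(\<lambda>j. M / r ^ i * \<theta> * \<theta> ^ j) sums (M / r ^ i * \<theta> * (1 / (1 - \<theta>)))"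
    using \<theta> by (intro sums_mult geometric_sums) auto
  have "norm ((g - (\<Sum>j<i. c j * h ^ j)) / h ^ i - c i) = norm (\<Sum>j. c (Suc j + i) * h ^ Suc j)"
    using s by (simp add: sums_iff)
  also have "\<dots> \<le> (\<Sum>j. M / r ^ i * \<theta> * \<theta> ^ j)"
    by (intro norm_suminf_le le sums_summable[OF g])
  also have "\<dots> = M / r ^ i * \<theta> * (1 / (1 - \<theta>))" using g by (simp add: sums_iff)
  \<comment> \<open>The ratio is at most 1/2, so the factor \<open>1 / (1 - \<theta>)\<close> is at
    most 2.\<close>
  also have "\<dots> \<le> M / r ^ i * \<theta> * 2"
    using \<theta> M r by (intro mult_left_mono) (auto simp: field_simps)
  also have "\<dots> = 2 * M * norm h / r ^ Suc i" unfolding \<theta>_def by (simp add: mult_ac)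
  finally show ?thesis .
qed

text \<open>A locally bounded, separately holomorphic function has coefficients in the first variable
  that are uniform limits of holomorphic functions of the second variable.\<close>

lemma slice_coeff:
  fixes G :: "complex \<times> complex \<Rightarrow> complex"
  assumes R: "0 < R"
    and hx: "\<And>y. y \<in> ball v R \<Longrightarrow> (\<lambda>x. G (x, y)) holomorphic_on ball u R"
    and hy: "\<And>x. x \<in> ball u R \<Longrightarrow> (\<lambda>y. G (x, y)) holomorphic_on ball v R"
    and bd: "\<And>x y. x \<in> ball u R \<Longrightarrow> y \<in> ball v R \<Longrightarrow> norm (G (x, y)) \<le> M"
  defines "a \<equiv> \<lambda>i y. (deriv ^^ i) (\<lambda>x. G (x, y)) u / fact i"
  shows "\<And>i y. y \<in> ball v R \<Longrightarrow> norm (a i y) \<le> M / (R / 2) ^ i"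
    and "\<And>i. a i holomorphic_on ball v R"
proof -
  define r where "r = R / 2"
  have r: "0 < r" "r < R" using R by (auto simp: r_def)
  show bound: "norm (a i y) \<le> M / (R / 2) ^ i" if y: "y \<in> ball v R" for i y
  proof -
    have "norm ((deriv ^^ i) (\<lambda>x. G (x, y)) u) \<le> fact i * M / r ^ i"
      using r hx[OF y] bd[OF _ y]
      by (intro Cauchy_inequality)
         (auto intro!: holomorphic_on_imp_continuous_on elim: holomorphic_on_subset simp: dist_norm)
    then show ?thesis
      unfolding a_def r_def[symmetric] norm_divide by (simp add: divide_le_eq mult.commute)
  qed
  have sums: "(\<lambda>j. a j y * h ^ j) sums G (u + h, y)" if "y \<in> ball v R" "norm h < R" for y h
    using holomorphic_power_series[OF hx[OF that(1)], of "u + h"] that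
    unfolding a_def by (simp add: dist_norm)
  show "a i holomorphic_on ball v R" for i
  \<comment> \<open>The quotients converging to \<open>a i\<close> involve only the coefficients of
    smaller index, which are holomorphic by induction.\<close>
  proof (induction i rule: less_induct)
    case (less i)
    \<comment> \<open>Nonzero increments tending to 0, within the radius \<open>r / 2\<close> that
      \<open>power_series_tail_bound\<close> allows.\<close>
    define h :: "nat \<Rightarrow> complex" where "h n = of_real (r / 2 * (1/2) ^ n)" for n
    have h0: "h n \<noteq> 0" for n using r by (simp add: h_def)
    have hn: "norm (h n) = r / 2 * (1/2) ^ n" for n using r by (simp add: h_def norm_mult norm_power)
    have hr: "norm (h n) \<le> r / 2" for n
      unfolding hn using r by (simp add: mult_le_cancel_left1 power_le_one)
    have hR: "norm (h n) < R" for n using hr[of n] r by linarith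
    define f where "f n y = (G (u + h n, y) - (\<Sum>j<i. a j y * h n ^ j)) / h n ^ i" for n y
    have hol: "f n holomorphic_on ball v R" for n
      unfolding f_def using h0 hR[of n] less
      by (intro holomorphic_intros hy) (auto simp: dist_norm)
    have est: "norm (f n y - a i y) \<le> 2 * M * norm (h n) / r ^ Suc i" if "y \<in> ball v R" for n y
      unfolding f_def using bound[OF that] r h0 hr hR
      by (intro power_series_tail_bound sums that) (auto simp: r_def)
    have lim: "(\<lambda>n. 2 * M * norm (h n) / r ^ Suc i) \<longlonglongrightarrow> 0"
    proof -
      have "(\<lambda>n. 2 * M * (r / 2 * (1/2) ^ n) / r ^ Suc i) \<longlonglongrightarrow> 2 * M * (r / 2 * 0) / r ^ Suc i"
        by (intro tendsto_intros LIMSEQ_power_zero) (use r in auto)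
      then show ?thesis unfolding hn by simp
    qed
    have ul: "uniform_limit (ball v R) f (a i) sequentially"
    proof (rule uniform_limitI)
      fix e :: real assume "0 < e"
      with lim have "\<forall>\<^sub>F n in sequentially. 2 * M * norm (h n) / r ^ Suc i < e"
        by (rule order_tendstoD)
      then show "\<forall>\<^sub>F n in sequentially. \<forall>y\<in>ball v R. dist (f n y) (a i y) < e"
        by eventually_elim (simp add: dist_norm le_less_trans[OF est])
    qed
    show ?case
    proof (rule holomorphic_uniform_sequence[OF open_ball hol])
      fix y assume "y \<in> ball v R"
      then obtain d where "0 < d" "cball y d \<subseteq> ball v R"
        using open_contains_cball open_ball by blast
      with ul show "\<exists>d>0. cball y d \<subseteq> ball v R \<and> uniform_limit (cball y d) f (a i) sequentially"
        using uniform_limit_on_subset by blast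
    qed
  qed
qed

text \<open>Continuity is joint, so that \<open>G\<close> is bounded on compact bidiscs and
  preimages of open sets contain bidiscs. Holomorphy is separate, so that the theory of one variable
  applies to each slice.\<close>

definition hol2_at :: "(complex \<times> complex \<Rightarrow> complex) \<Rightarrow> complex \<times> complex \<Rightarrow> bool" where
  "hol2_at G z \<longleftrightarrow> (\<exists>e>0. continuous_on (ball (fst z) e \<times> ball (snd z) e) G \<and>
     (\<forall>y\<in>ball (snd z) e. (\<lambda>x. G (x, y)) holomorphic_on ball (fst z) e) \<and>
     (\<forall>x\<in>ball (fst z) e. (\<lambda>y. G (x, y)) holomorphic_on ball (snd z) e))"

lemma geometric_summable_on_Times:
  "(\<lambda>(i, j). M * (1/2) ^ i * (1/2) ^ j :: real) summable_on (UNIV :: (nat \<times> nat) set)"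
proof -
  have g: "((\<lambda>j::nat. (1/2 :: real) ^ j) has_sum 2) UNIV"
    using geometric_sums[of "1/2 :: real"] summable_geometric[of "1/2 :: real"]
    by (intro norm_summable_imp_has_sum) (auto simp: norm_power)
  have "(\<lambda>(i, j). (1/2) ^ i * (1/2) ^ j :: real) summable_on Sigma (UNIV :: nat set) (\<lambda>_. UNIV :: nat set)"
  proof (rule summable_on_SigmaI)
    show "((\<lambda>j. case (i, j) of (i, j) \<Rightarrow> (1/2) ^ i * (1/2) ^ j) has_sum ((1/2) ^ i * 2 :: real)) UNIV"
      for i :: nat
      using has_sum_cmult_right[OF g] by simp
    show "(\<lambda>i. (1/2) ^ i * 2 :: real) summable_on (UNIV :: nat set)"
      using has_sum_cmult_left[OF g] by (auto simp: summable_on_def)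
  qed auto
  from summable_on_cmult_right[OF this, of M] show ?thesis
    by (simp add: case_prod_unfold mult.assoc)
qed

text \<open>Expand in the first variable, then expand each coefficient, holomorphic by
  \<open>slice_coeff\<close>, in the second. Cauchy's inequality applied twice bounds the
  coefficients by \<open>M / r ^ i / r ^ j\<close>, so the double series converges absolutely near
  the centre and the iterated sum is its unconditional sum.\<close>

lemma hol2_at_double_series:
  assumes "hol2_at G (u, v)"
  obtains c :: "nat \<times> nat \<Rightarrow> complex" and r where "0 < r"
    "\<And>x y. norm (x - u) < r \<Longrightarrow> norm (y - v) < r \<Longrightarrow>
       ((\<lambda>(i, j). c (i, j) * (x - u) ^ i * (y - v) ^ j) has_sum G (x, y)) UNIV"
proof -
  from assms obtain e where e: "0 < e" and cont: "continuous_on (ball u e \<times> ball v e) G"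
    and hx: "\<And>y. y \<in> ball v e \<Longrightarrow> (\<lambda>x. G (x, y)) holomorphic_on ball u e"
    and hy: "\<And>x. x \<in> ball u e \<Longrightarrow> (\<lambda>y. G (x, y)) holomorphic_on ball v e"
    unfolding hol2_at_def by auto
  \<comment> \<open>Three halvings follow: \<open>R\<close> puts a compact bidisc inside the domain,
    \<open>r = R / 2\<close> leaves room for Cauchy's inequality, and \<open>r / 2\<close> gives a
    geometric majorant of ratio 1/2.\<close>
  define R where "R = e / 2"
  have R: "0 < R" "R < e" using e by (auto simp: R_def)
  have sub: "cball u R \<subseteq> ball u e" "cball v R \<subseteq> ball v e"
    "ball u R \<subseteq> ball u e" "ball v R \<subseteq> ball v e" using R by auto
  have "compact (cball u R \<times> cball v R)" by (intro compact_Times compact_cball)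
  moreover have "continuous_on (cball u R \<times> cball v R) G"
    using cont by (rule continuous_on_subset) (use sub in auto)
  ultimately obtain M where M: "\<And>p. p \<in> cball u R \<times> cball v R \<Longrightarrow> norm (G p) \<le> M"
    using continuous_on_compact_bound by blast
  define a where "a i y = (deriv ^^ i) (\<lambda>x. G (x, y)) u / fact i" for i y
  have ab: "norm (a i y) \<le> M / (R / 2) ^ i" if "y \<in> ball v R" for i y
    unfolding a_def using that sub M
    by (intro slice_coeff(1)[where v = v]) (auto intro!: R holomorphic_on_subset[OF hx] holomorphic_on_subset[OF hy])
  have ah: "a i holomorphic_on ball v R" for i
    unfolding a_def using sub M
    by (intro slice_coeff(2)[where v = v and M = M]) (auto intro!: R holomorphic_on_subset[OF hx] holomorphic_on_subset[OF hy])
  define r where "r = R / 2"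
  have r: "0 < r" "r < R" using R by (auto simp: r_def)
  define c where "c = (\<lambda>(i, j). (deriv ^^ j) (a i) v / fact j)"
  have cb: "norm (c (i, j)) \<le> M / r ^ i / r ^ j" for i j
  proof -
    have "norm ((deriv ^^ j) (a i) v) \<le> fact j * (M / r ^ i) / r ^ j"
      using r ah[of i] ab[of _ i]
      by (intro Cauchy_inequality)
         (auto intro!: holomorphic_on_imp_continuous_on elim: holomorphic_on_subset
           simp: dist_norm r_def[symmetric])
    then show ?thesis
      unfolding c_def by (simp add: norm_divide divide_le_eq mult.commute)
  qed
  have "((\<lambda>(i, j). c (i, j) * (x - u) ^ i * (y - v) ^ j) has_sum G (x, y)) UNIV"
    if xy: "norm (x - u) < r / 2" "norm (y - v) < r / 2" for x y
  proof -
    let ?f = "\<lambda>(i, j). c (i, j) * (x - u) ^ i * (y - v) ^ j"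
    have M0: "0 \<le> M" using order_trans[OF norm_ge_zero M[of "(u, v)"]] R by simp
    have x: "x \<in> ball u R" and y: "y \<in> ball v R" using xy r by (auto simp: dist_norm norm_minus_commute)
    have fb: "norm (?f (i, j)) \<le> M * (1/2) ^ i * (1/2) ^ j" for i j
    proof -
      have "norm (?f (i, j)) \<le> M / r ^ i / r ^ j * (r / 2) ^ i * (r / 2) ^ j"
        using xy r M0 unfolding case_prod_conv norm_mult norm_power
        by (intro mult_mono cb power_mono) auto
      also have "\<dots> = M * (1/2) ^ i * (1/2) ^ j" using r by (simp add: power_divide)
      finally show ?thesis .
    qed
    have "(\<lambda>p. norm (?f p)) summable_on UNIV"
      by (rule summable_on_comparison_test[OF geometric_summable_on_Times[of M]]) (use fb in auto)
    then have fs: "?f summable_on UNIV" by (rule abs_summable_summable)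
    have hs: "(f has_sum S) UNIV" if "f sums S" "\<And>n. norm (f n) \<le> K * (1/2) ^ n" for f :: "nat \<Rightarrow> complex" and S K
    proof (rule norm_summable_imp_has_sum[OF _ that(1)])
      show "summable (\<lambda>n. norm (f n))"
        by (rule summable_comparison_test'[OF summable_mult[OF summable_geometric[of "1/2 :: real"]]])
           (use that(2) in auto)
    qed
    have "(?f has_sum G (x, y)) (Sigma UNIV (\<lambda>_. UNIV))"
    proof (rule has_sum_SigmaI)
      fix i
      have "(\<lambda>j. c (i, j) * (y - v) ^ j) sums a i y"
        using holomorphic_power_series[OF ah y] unfolding c_def by simp
      from sums_mult[OF this, of "(x - u) ^ i"]
      have "(\<lambda>j. ?f (i, j)) sums (a i y * (x - u) ^ i)" by (simp add: mult_ac)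
      then show "((\<lambda>j. ?f (i, j)) has_sum (a i y * (x - u) ^ i)) UNIV"
        by (rule hs[where K = "M * (1/2) ^ i"]) (use fb in auto)
    next
      have "(\<lambda>i. a i y * (x - u) ^ i) sums G (x, y)"
        using holomorphic_power_series[OF holomorphic_on_subset[OF hx sub(3)] x] y sub
        unfolding a_def by auto
      then show "((\<lambda>i. a i y * (x - u) ^ i) has_sum G (x, y)) UNIV"
      proof (rule hs)
        fix i
        have "norm (a i y * (x - u) ^ i) \<le> M / r ^ i * (r / 2) ^ i"
          using xy r M0 ab[OF y, of i] unfolding norm_mult norm_power r_def[symmetric]
          by (intro mult_mono power_mono) auto
        also have "\<dots> = M * (1/2) ^ i" using r by (simp add: power_divide)
        finally show "norm (a i y * (x - u) ^ i) \<le> M * (1/2) ^ i" .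
      qed
    qed (use fs in simp)
    then show ?thesis by simp
  qed
  with r show ?thesis by (intro that[of "r / 2" c]) auto
qed

lemma hol2_at_compose:
  assumes G: "hol2_at G z" and g: "g holomorphic_on S" "open S" "G z \<in> S"
  shows "hol2_at (\<lambda>p. g (G p)) z"
proof -
  obtain u v where z: "z = (u, v)" by (cases z)
  from G obtain e where e: "0 < e" and cont: "continuous_on (ball u e \<times> ball v e) G"
    and hx: "\<And>y. y \<in> ball v e \<Longrightarrow> (\<lambda>x. G (x, y)) holomorphic_on ball u e"
    and hy: "\<And>x. x \<in> ball u e \<Longrightarrow> (\<lambda>y. G (x, y)) holomorphic_on ball v e"
    unfolding hol2_at_def z by auto
  \<comment> \<open>Joint continuity makes the preimage of \<open>S\<close> open in the plane, so it
    contains a product neighbourhood and hence a smaller bidisc.\<close>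
  have "open (ball u e \<times> ball v e)" by (intro open_Times open_ball)
  with cont g(2) have "open (G -` S \<inter> (ball u e \<times> ball v e))"
    by (simp add: continuous_on_open_vimage Int_commute)
  then obtain A B where AB: "open A" "open B" "u \<in> A" "v \<in> B"
    "A \<times> B \<subseteq> G -` S \<inter> (ball u e \<times> ball v e)"
    using g(3) e unfolding z by (elim open_prod_elim[of _ "(u, v)"]) auto
  obtain d1 where d1: "0 < d1" "ball u d1 \<subseteq> A" using AB(1,3) open_contains_ball by blast
  obtain d2 where d2: "0 < d2" "ball v d2 \<subseteq> B" using AB(2,4) open_contains_ball by blast
  define d where "d = min d1 d2"
  have d: "0 < d" "ball u d \<subseteq> A" "ball v d \<subseteq> B" using d1 d2 by (auto simp: d_def)
  have sub: "G (x, y) \<in> S" "x \<in> ball u e" "y \<in> ball v e" if "x \<in> ball u d" "y \<in> ball v d" for x y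
  proof -
    have "(x, y) \<in> A \<times> B" using that d by blast
    then have "(x, y) \<in> G -` S \<inter> (ball u e \<times> ball v e)" using AB(5) by blast
    then show "G (x, y) \<in> S" "x \<in> ball u e" "y \<in> ball v e" by auto
  qed
  have uv: "u \<in> ball u d" "v \<in> ball v d" using d by auto
  show ?thesis unfolding hol2_at_def z fst_conv snd_conv
  proof (intro exI[of _ d] conjI ballI d(1))
    show "continuous_on (ball u d \<times> ball v d) (\<lambda>p. g (G p))"
      using sub by (intro continuous_on_compose2[OF holomorphic_on_imp_continuous_on[OF g(1)]]
        continuous_on_subset[OF cont]) auto
    fix y assume y: "y \<in> ball v d"
    have "(g \<circ> (\<lambda>x. G (x, y))) holomorphic_on ball u d"
      by (rule holomorphic_on_compose_gen[OF holomorphic_on_subset[OF hx] g(1)])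
         (use sub y uv in blast)+
    then show "(\<lambda>x. g (G (x, y))) holomorphic_on ball u d" by (simp add: o_def)
  next
    fix x assume x: "x \<in> ball u d"
    have "(g \<circ> (\<lambda>y. G (x, y))) holomorphic_on ball v d"
      by (rule holomorphic_on_compose_gen[OF holomorphic_on_subset[OF hy] g(1)])
         (use sub x uv in blast)+
    then show "(\<lambda>y. g (G (x, y))) holomorphic_on ball v d" by (simp add: o_def)
  qed
qed

lemma hol2_at_binary:
  assumes F: "hol2_at F z" and G: "hol2_at G z"
  shows "hol2_at (\<lambda>p. F p + G p) z" "hol2_at (\<lambda>p. F p * G p) z"
proof -
  obtain u v where z: "z = (u, v)" by (cases z)
  from F obtain e1 where e1: "0 < e1" "continuous_on (ball u e1 \<times> ball v e1) F"
    "\<And>y. y \<in> ball v e1 \<Longrightarrow> (\<lambda>x. F (x, y)) holomorphic_on ball u e1"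
    "\<And>x. x \<in> ball u e1 \<Longrightarrow> (\<lambda>y. F (x, y)) holomorphic_on ball v e1"
    unfolding hol2_at_def z by auto
  from G obtain e2 where e2: "0 < e2" "continuous_on (ball u e2 \<times> ball v e2) G"
    "\<And>y. y \<in> ball v e2 \<Longrightarrow> (\<lambda>x. G (x, y)) holomorphic_on ball u e2"
    "\<And>x. x \<in> ball u e2 \<Longrightarrow> (\<lambda>y. G (x, y)) holomorphic_on ball v e2"
    unfolding hol2_at_def z by auto
  define e where "e = min e1 e2"
  have e: "0 < e" "\<And>w. ball w e \<subseteq> ball w e1" "\<And>w. ball w e \<subseteq> ball w e2"
    using e1(1) e2(1) by (auto simp: e_def)
  note c = continuous_on_subset[OF e1(2), of "ball u e \<times> ball v e"]
    continuous_on_subset[OF e2(2), of "ball u e \<times> ball v e"]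
  have mem: "\<And>x w. x \<in> ball w e \<Longrightarrow> x \<in> ball w e1" "\<And>x w. x \<in> ball w e \<Longrightarrow> x \<in> ball w e2"
    using e by blast+
  note h = holomorphic_on_subset[OF e1(3) e(2)] holomorphic_on_subset[OF e1(4) e(2)]
    holomorphic_on_subset[OF e2(3) e(3)] holomorphic_on_subset[OF e2(4) e(3)]
  show "hol2_at (\<lambda>p. F p + G p) z"
    unfolding hol2_at_def z fst_conv snd_conv
    by (intro exI[of _ e] conjI ballI e(1) continuous_intros c holomorphic_intros h mem Sigma_mono e)
  show "hol2_at (\<lambda>p. F p * G p) z"
    unfolding hol2_at_def z fst_conv snd_conv
    by (intro exI[of _ e] conjI ballI e(1) continuous_intros c holomorphic_intros h mem Sigma_mono e)
qed

lemma hol2_at_basic: "hol2_at (\<lambda>p. c) z" "hol2_at fst z" "hol2_at snd z"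
  unfolding hol2_at_def
  by (intro exI[of _ 1] conjI ballI; simp add: continuous_on_fst continuous_on_snd continuous_on_id)+

text \<open>Analyticity is encoded by a complex extension near \<open>z\<close>. Closure under
  operations then needs no manipulation of double series; a series is extracted only once, in
  \<open>real_analytic2_onI\<close>.\<close>

definition ranalytic2_at :: "(real \<times> real \<Rightarrow> real) \<Rightarrow> real \<times> real \<Rightarrow> bool" where
  "ranalytic2_at F z \<longleftrightarrow> (\<exists>G. hol2_at G (of_real (fst z), of_real (snd z)) \<and>
     (\<forall>\<^sub>F p in nhds z. G (of_real (fst p), of_real (snd p)) = of_real (F p)))"

lemma ranalytic2_at_cong:
  assumes "ranalytic2_at F z" "\<forall>\<^sub>F p in nhds z. F p = F' p"
  shows "ranalytic2_at F' z"
proof -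
  from assms(1) obtain G where G: "hol2_at G (of_real (fst z), of_real (snd z))"
    "\<forall>\<^sub>F p in nhds z. G (of_real (fst p), of_real (snd p)) = of_real (F p)"
    unfolding ranalytic2_at_def by blast
  from G(2) assms(2) have "\<forall>\<^sub>F p in nhds z. G (of_real (fst p), of_real (snd p)) = of_real (F' p)"
    by eventually_elim simp
  with G(1) show ?thesis unfolding ranalytic2_at_def by blast
qed

lemma ranalytic2_at_const: "ranalytic2_at (\<lambda>p. c) z"
  and ranalytic2_at_fst: "ranalytic2_at fst z"
  and ranalytic2_at_snd: "ranalytic2_at snd z"
  unfolding ranalytic2_at_def
  using hol2_at_basic(1)[where c = "of_real c"] hol2_at_basic(2,3) by (force intro!: always_eventually)+

lemma
  assumes "ranalytic2_at F z" "ranalytic2_at H z"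
  shows ranalytic2_at_add: "ranalytic2_at (\<lambda>p. F p + H p) z"
    and ranalytic2_at_mult: "ranalytic2_at (\<lambda>p. F p * H p) z"
proof -
  from assms obtain G K where G: "hol2_at G (of_real (fst z), of_real (snd z))"
    "\<forall>\<^sub>F p in nhds z. G (of_real (fst p), of_real (snd p)) = of_real (F p)"
    and K: "hol2_at K (of_real (fst z), of_real (snd z))"
    "\<forall>\<^sub>F p in nhds z. K (of_real (fst p), of_real (snd p)) = of_real (H p)"
    unfolding ranalytic2_at_def by blast
  have "\<forall>\<^sub>F p in nhds z. G (of_real (fst p), of_real (snd p)) + K (of_real (fst p), of_real (snd p))
      = of_real (F p + H p)"
    using G(2) K(2) by eventually_elim simp
  with hol2_at_binary(1)[OF G(1) K(1)] show "ranalytic2_at (\<lambda>p. F p + H p) z"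
    unfolding ranalytic2_at_def by blast
  have "\<forall>\<^sub>F p in nhds z. G (of_real (fst p), of_real (snd p)) * K (of_real (fst p), of_real (snd p))
      = of_real (F p * H p)"
    using G(2) K(2) by eventually_elim simp
  with hol2_at_binary(2)[OF G(1) K(1)] show "ranalytic2_at (\<lambda>p. F p * H p) z"
    unfolding ranalytic2_at_def by blast
qed

text \<open>The common source of the rules for \<open>inverse\<close>, \<open>exp\<close>,
  \<open>sqrt\<close> and \<open>arctan\<close>: each is the restriction to the reals of a function
  holomorphic on a suitable open \<open>S\<close>. Continuity of the extension keeps its values in
  \<open>S\<close> near \<open>z\<close>.\<close>

lemma ranalytic2_at_compose:
  assumes F: "ranalytic2_at F z" and g: "g holomorphic_on S" "open S" "of_real (F z) \<in> S"
    and h: "\<And>x. of_real x \<in> S \<Longrightarrow> g (of_real x) = of_real (h x)"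
  shows "ranalytic2_at (\<lambda>p. h (F p)) z"
proof -
  from F obtain G where G: "hol2_at G (of_real (fst z), of_real (snd z))"
    and ev: "\<forall>\<^sub>F p in nhds z. G (of_real (fst p), of_real (snd p)) = of_real (F p)"
    unfolding ranalytic2_at_def by blast
  let ?j = "\<lambda>p :: real \<times> real. (complex_of_real (fst p), complex_of_real (snd p))"
  have z: "G (?j z) = of_real (F z)" using ev by (rule eventually_nhds_x_imp_x)
  have "isCont G (?j z)"
  proof -
    from G obtain e where "0 < e"
      "continuous_on (ball (fst (?j z)) e \<times> ball (snd (?j z)) e) G"
      unfolding hol2_at_def by blast
    then show ?thesis
      by (subst (asm) continuous_on_eq_continuous_at) (auto intro!: open_Times)
  qed
  moreover have "isCont ?j z" by (intro continuous_intros)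
  ultimately have "isCont (\<lambda>p. G (?j p)) z" using isCont_o2 by blast
  then have "\<forall>\<^sub>F p in at z. G (?j p) \<in> S"
    unfolding continuous_at by (rule topological_tendstoD) (use g z in auto)
  then have "\<forall>\<^sub>F p in nhds z. G (?j p) \<in> S"
    using g z by (simp add: eventually_nhds_conv_at)
  with ev have "\<forall>\<^sub>F p in nhds z. g (G (?j p)) = of_real (h (F p))"
    by eventually_elim (metis h)
  moreover have "hol2_at (\<lambda>p. g (G p)) (?j z)"
    by (rule hol2_at_compose[OF G g(1,2)]) (simp only: z g(3))
  ultimately show ?thesis unfolding ranalytic2_at_def by blast
qed

section \<open>Elementary functions of analytic functions\<close>

lemma ranalytic2_at_inverse:
  assumes "ranalytic2_at F z" "F z \<noteq> 0"
  shows "ranalytic2_at (\<lambda>p. inverse (F p)) z"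
  by (rule ranalytic2_at_compose[OF assms(1), of inverse "- {0}"])
     (use assms(2) in \<open>auto intro!: holomorphic_intros\<close>)

lemma ranalytic2_at_divide:
  assumes "ranalytic2_at F z" "ranalytic2_at H z" "H z \<noteq> 0"
  shows "ranalytic2_at (\<lambda>p. F p / H p) z"
  using ranalytic2_at_mult[OF assms(1) ranalytic2_at_inverse[OF assms(2,3)]]
  by (simp add: divide_inverse)

lemma ranalytic2_at_diff:
  assumes "ranalytic2_at F z" "ranalytic2_at H z"
  shows "ranalytic2_at (\<lambda>p. F p - H p) z"
  using ranalytic2_at_add[OF assms(1) ranalytic2_at_mult[OF ranalytic2_at_const[of "-1"] assms(2)]]
  by simp

lemma ranalytic2_at_exp:
  assumes "ranalytic2_at F z"
  shows "ranalytic2_at (\<lambda>p. exp (F p)) z"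
  by (rule ranalytic2_at_compose[OF assms, of exp UNIV])
     (auto intro!: holomorphic_intros simp: exp_of_real)

lemma ranalytic2_at_sqrt:
  assumes "ranalytic2_at F z" "0 < F z"
  shows "ranalytic2_at (\<lambda>p. sqrt (F p)) z"
proof (rule ranalytic2_at_compose[OF assms(1)])
  show "csqrt holomorphic_on - \<real>\<^sub>\<le>\<^sub>0" by (rule holomorphic_on_csqrt)
qed (use assms(2) in \<open>auto simp: csqrt_of_real\<close>)

lemma ranalytic2_at_arctan:
  assumes "ranalytic2_at F z"
  shows "ranalytic2_at (\<lambda>p. arctan (F p)) z"
proof (rule ranalytic2_at_compose[OF assms])
  \<comment> \<open>The branch cuts of \<open>Arctan\<close> lie on the imaginary axis outside this
    strip, while the strip contains the whole real line.\<close>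
  show "Arctan holomorphic_on {w. \<bar>Im w\<bar> < 1}" by (rule holomorphic_on_Arctan) auto
  show "open {w. \<bar>Im w\<bar> < 1}" by (intro open_Collect_less continuous_intros)
qed (auto simp: Arctan_of_real)

lemma ranalytic2_at_minus:
  assumes "ranalytic2_at F z"
  shows "ranalytic2_at (\<lambda>p. - F p) z"
  using ranalytic2_at_diff[OF ranalytic2_at_const[of 0] assms] by simp

lemma ranalytic2_at_power:
  assumes "ranalytic2_at F z"
  shows "ranalytic2_at (\<lambda>p. F p ^ n) z"
  by (induction n) (simp_all add: ranalytic2_at_const ranalytic2_at_mult assms)

lemmas ranalytic2_intros =
  ranalytic2_at_const ranalytic2_at_fst ranalytic2_at_snd ranalytic2_at_add ranalytic2_at_diff
  ranalytic2_at_minus ranalytic2_at_mult ranalytic2_at_power ranalytic2_at_divide ranalytic2_at_exp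
  ranalytic2_at_arctan ranalytic2_at_sqrt

text \<open>At real points all powers in the complex double series are real and its sum is real, so
  the real parts of the coefficients give a real series with the same sum.\<close>

lemma real_analytic2_onI:
  assumes "\<And>z. z \<in> S \<Longrightarrow> ranalytic2_at F z"
  shows "real_analytic2_on F S"
  unfolding real_analytic2_on_def
proof (intro ballI, clarify)
  fix u v :: real assume "(u, v) \<in> S"
  from assms[OF this] obtain G where G: "hol2_at G (of_real u, of_real v)"
    and ev: "\<forall>\<^sub>F p in nhds (u, v). G (of_real (fst p), of_real (snd p)) = of_real (F p)"
    unfolding ranalytic2_at_def by auto
  obtain c :: "nat \<times> nat \<Rightarrow> complex" and r where r: "0 < r"
    and c: "\<And>x y. norm (x - of_real u) < r \<Longrightarrow> norm (y - of_real v) < r \<Longrightarrow>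
       ((\<lambda>(i, j). c (i, j) * (x - of_real u) ^ i * (y - of_real v) ^ j) has_sum G (x, y)) UNIV"
    by (rule hol2_at_double_series[OF G]) blast
  obtain A B where AB: "open A" "open B" "u \<in> A" "v \<in> B"
    and eq: "\<And>x y. x \<in> A \<Longrightarrow> y \<in> B \<Longrightarrow> G (of_real x, of_real y) = of_real (F (x, y))"
  proof -
    from ev obtain W where W: "open W" "(u, v) \<in> W"
      "\<forall>p\<in>W. G (of_real (fst p), of_real (snd p)) = of_real (F p)"
      unfolding eventually_nhds by blast
    obtain A B where "open A" "open B" "(u, v) \<in> A \<times> B" "A \<times> B \<subseteq> W"
      by (rule open_prod_elim[OF W(1,2)])
    moreover have "G (of_real x, of_real y) = of_real (F (x, y))" if "x \<in> A" "y \<in> B" for x y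
      using W(3) \<open>A \<times> B \<subseteq> W\<close> that by force
    ultimately show ?thesis by (intro that[of A B]) auto
  qed
  obtain d1 where d1: "0 < d1" "ball u d1 \<subseteq> A" using AB(1,3) open_contains_ball by blast
  obtain d2 where d2: "0 < d2" "ball v d2 \<subseteq> B" using AB(2,4) open_contains_ball by blast
  define d where "d = min r (min d1 d2)"
  have "((\<lambda>(i, j). Re (c (i, j)) * (x - u) ^ i * (y - v) ^ j) has_sum F (x, y)) UNIV"
    if "\<bar>x - u\<bar> < d" "\<bar>y - v\<bar> < d" for x y
  proof -
    have "norm (complex_of_real x - of_real u) < r" "norm (complex_of_real y - of_real v) < r"
      using that unfolding d_def by (simp_all flip: of_real_diff)
    from has_sum_Re[OF c[OF this]]
    have "((\<lambda>p. Re (case p of (i, j) \<Rightarrow> c (i, j) * (of_real x - of_real u) ^ i * (of_real y - of_real v) ^ j))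
        has_sum Re (G (of_real x, of_real y))) UNIV" .
    moreover have "Re (case p of (i, j) \<Rightarrow> c (i, j) * (of_real x - of_real u) ^ i * (of_real y - of_real v) ^ j)
       = (case p of (i, j) \<Rightarrow> Re (c (i, j)) * (x - u) ^ i * (y - v) ^ j)" for p
      by (cases p) (simp flip: of_real_diff of_real_power)
    moreover have "x \<in> A" "y \<in> B"
      using that d1 d2 unfolding d_def by (auto simp: dist_real_def abs_minus_commute)
    then have "G (of_real x, of_real y) = of_real (F (x, y))" by (rule eq)
    ultimately show ?thesis by simp
  qed
  moreover have "0 < d" using r d1 d2 by (simp add: d_def)
  ultimately show "\<exists>(c :: nat \<times> nat \<Rightarrow> real) r. 0 < r \<and> (\<forall>x y. \<bar>x - u\<bar> < r \<longrightarrow> \<bar>y - v\<bar> < r \<longrightarrow>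
      ((\<lambda>(i, j). c (i, j) * (x - u) ^ i * (y - v) ^ j) has_sum F (x, y)) UNIV)"
    by (intro exI[of _ "\<lambda>p. Re (c p)"] exI[of _ d]) auto
qed

section \<open>The oscillator of the central band\<close>

text \<open>The angular frequency of \<open>u'' + \<sigma> * u' + u = 0\<close> for
  \<open>\<bar>\<sigma>\<bar> = 1\<close>: the characteristic roots have real part
  \<open>- \<sigma> / 2\<close> and imaginary parts \<open>om\<close> and
  \<open>- om\<close>.\<close>

definition om :: real where "om = sqrt 3 / 2"

lemma om_pos [simp]: "0 < om" and om_sq: "om\<^sup>2 = 3/4"
  by (auto simp: om_def power_divide)

lemma om_nz [simp]: "om \<noteq> 0"
  using om_pos by linarith

text \<open>
  The solution of \<open>u'' + \<sigma> * u' + u = 0\<close> with \<open>u 0 = 1\<close>, \<open>u' 0 = \<rho>\<close>, and its conjugate coordinate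
  \<open>(u' + \<sigma> / 2 * u) / om\<close>, in which the flow is a rotation times \<open>exp (- \<sigma> * T / 2)\<close>.
\<close>

definition oscU :: "real \<Rightarrow> real \<Rightarrow> real \<Rightarrow> real" where
  "oscU \<sigma> \<rho> T = exp (- (\<sigma> * T / 2)) * (cos (om * T) + (\<rho> + \<sigma> / 2) / om * sin (om * T))"

definition oscV :: "real \<Rightarrow> real \<Rightarrow> real \<Rightarrow> real" where
  "oscV \<sigma> \<rho> T = exp (- (\<sigma> * T / 2)) * ((\<rho> + \<sigma> / 2) / om * cos (om * T) - sin (om * T))"

text \<open>The angle to be turned divided by the angular velocity. The summand \<open>pi\<close>
  arises because the start has \<open>u > 0\<close> while the end lies on the opposite half of its
  line, where \<open>u < 0\<close>.\<close>

definition transit_time :: "real \<Rightarrow> real \<Rightarrow> real \<Rightarrow> real" where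
  "transit_time \<sigma> \<rho> l = (pi + arctan ((\<rho> + \<sigma> / 2) / om) - arctan ((l + \<sigma> / 2) / om)) / om"

text \<open>The damping factor times the ratio of the cosines of the two ray angles; the square root
  is that ratio, written in the slopes.\<close>

definition transit_ratio :: "real \<Rightarrow> real \<Rightarrow> real \<Rightarrow> real" where
  "transit_ratio \<sigma> \<rho> l = exp (- (\<sigma> * transit_time \<sigma> \<rho> l / 2)) *
     sqrt ((1 + \<sigma> * \<rho> + \<rho>\<^sup>2) / (1 + \<sigma> * l + l\<^sup>2))"

lemma osc_deriv:
  "(oscU \<sigma> \<rho> has_real_derivative om * oscV \<sigma> \<rho> T - \<sigma> / 2 * oscU \<sigma> \<rho> T) (at T within S)"
  "(oscV \<sigma> \<rho> has_real_derivative - om * oscU \<sigma> \<rho> T - \<sigma> / 2 * oscV \<sigma> \<rho> T) (at T within S)"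
proof -
  define p where "p = (\<rho> + \<sigma> / 2) / om"
  have "((\<lambda>T. exp (- (\<sigma> * T / 2)) * (cos (om * T) + p * sin (om * T))) has_real_derivative
      om * (exp (- (\<sigma> * T / 2)) * (p * cos (om * T) - sin (om * T))) -
      \<sigma> / 2 * (exp (- (\<sigma> * T / 2)) * (cos (om * T) + p * sin (om * T)))) (at T within S)"
    by (auto intro!: derivative_eq_intros simp: algebra_simps)
  then show "(oscU \<sigma> \<rho> has_real_derivative om * oscV \<sigma> \<rho> T - \<sigma> / 2 * oscU \<sigma> \<rho> T) (at T within S)"
    unfolding oscU_def[abs_def] oscV_def[abs_def] p_def .
  have "((\<lambda>T. exp (- (\<sigma> * T / 2)) * (p * cos (om * T) - sin (om * T))) has_real_derivative
      - om * (exp (- (\<sigma> * T / 2)) * (cos (om * T) + p * sin (om * T))) -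
      \<sigma> / 2 * (exp (- (\<sigma> * T / 2)) * (p * cos (om * T) - sin (om * T)))) (at T within S)"
    by (auto intro!: derivative_eq_intros simp: algebra_simps)
  then show "(oscV \<sigma> \<rho> has_real_derivative - om * oscU \<sigma> \<rho> T - \<sigma> / 2 * oscV \<sigma> \<rho> T) (at T within S)"
    unfolding oscU_def[abs_def] oscV_def[abs_def] p_def .
qed

lemma osc_0: "oscU \<sigma> \<rho> 0 = 1" "oscV \<sigma> \<rho> 0 = (\<rho> + \<sigma> / 2) / om"
  by (simp_all add: oscU_def oscV_def)

text \<open>A full turn changes only the amplitude. Comparing the orbit with itself one turn apart
  excludes longer flights through the band.\<close>

lemma osc_shift:
  "oscU \<sigma> \<rho> (T + 2 * pi / om) = exp (- (\<sigma> * pi / om)) * oscU \<sigma> \<rho> T"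
proof -
  have "- (\<sigma> * (T + 2 * c) / 2) = - (\<sigma> * c) + - (\<sigma> * T / 2)" for c :: real
    by (simp add: field_simps)
  from this[of "pi / om"]
  have e: "exp (- (\<sigma> * (T + 2 * pi / om) / 2)) = exp (- (\<sigma> * pi / om)) * exp (- (\<sigma> * T / 2))"
    unfolding times_divide_eq_right by (simp only: exp_add)
  have "om * (T + 2 * pi / om) = om * T + 2 * pi" by (simp only: distrib_left) simp
  then show ?thesis unfolding oscU_def e by (simp only: cos_periodic sin_periodic mult.assoc)
qed

lemma osc_polar:
  fixes \<sigma> \<rho> :: real
  defines "\<alpha> \<equiv> arctan ((\<rho> + \<sigma> / 2) / om)"
  shows "oscU \<sigma> \<rho> T = exp (- (\<sigma> * T / 2)) * (cos (om * T - \<alpha>) / cos \<alpha>)"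
    and "oscV \<sigma> \<rho> T = - exp (- (\<sigma> * T / 2)) * (sin (om * T - \<alpha>) / cos \<alpha>)"
proof -
  have c: "cos \<alpha> \<noteq> 0" unfolding \<alpha>_def by simp
  have "(\<rho> + \<sigma> / 2) / om = tan \<alpha>" unfolding \<alpha>_def by (simp add: tan_arctan)
  then have t: "(\<rho> + \<sigma> / 2) / om = sin \<alpha> / cos \<alpha>" by (simp add: tan_def)
  show "oscU \<sigma> \<rho> T = exp (- (\<sigma> * T / 2)) * (cos (om * T - \<alpha>) / cos \<alpha>)"
    unfolding oscU_def t cos_diff using c by (simp add: add_divide_distrib mult.commute)
  show "oscV \<sigma> \<rho> T = - exp (- (\<sigma> * T / 2)) * (sin (om * T - \<alpha>) / cos \<alpha>)"
    unfolding oscV_def t sin_diff using c by (simp add: diff_divide_distrib mult.commute right_diff_distrib)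
qed

text \<open>Completing the square: with \<open>\<sigma>\<^sup>2 = 1\<close> the quadratic equals
  \<open>(x + \<sigma> / 2)\<^sup>2 + om\<^sup>2\<close>, and
  \<open>om\<^sup>2 = 3/4\<close>.\<close>

lemma one_plus_slope_sq:
  assumes "\<bar>\<sigma>\<bar> = 1"
  shows "1 + ((x + \<sigma> / 2) / om)\<^sup>2 = (1 + \<sigma> * x + x\<^sup>2) * (4/3)"
proof -
  have "\<sigma>\<^sup>2 = 1" using assms by (metis power2_abs power_one)
  then show ?thesis by (simp add: power_divide om_sq power2_sum power_mult_distrib field_simps)
qed

lemma quad_pos:
  assumes "\<bar>\<sigma>\<bar> = (1::real)"
  shows "0 < 1 + \<sigma> * x + x\<^sup>2"
proof -
  have "0 < 1 + ((x + \<sigma> / 2) / om)\<^sup>2" by (intro add_pos_nonneg) auto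
  then show ?thesis unfolding one_plus_slope_sq[OF assms] by simp
qed

section \<open>Turning of the spiral from the ray of slope rho to the opposite ray of slope
  l\<close>

locale transit =
  fixes \<sigma> \<rho> l :: real
  assumes sigma: "\<bar>\<sigma>\<bar> = 1" and rho_neg: "\<rho> < 0" and l_pos: "0 < l"
begin

abbreviation "U \<equiv> oscU \<sigma> \<rho>"
abbreviation "V \<equiv> oscV \<sigma> \<rho>"
abbreviation "Tc \<equiv> transit_time \<sigma> \<rho> l"
abbreviation "Rc \<equiv> transit_ratio \<sigma> \<rho> l"
definition "q = (l + \<sigma> / 2) / om"

definition "\<alpha> = arctan ((\<rho> + \<sigma> / 2) / om)"
definition "\<beta> = arctan q"
definition "\<gamma> = arctan ((\<sigma> / 2) / om)"

lemma angles:
  "\<alpha> < \<gamma>" "\<gamma> < \<beta>" "- (pi/2) < \<alpha>" "\<alpha> < pi/2" "- (pi/2) < \<beta>" "\<beta> < pi/2" "0 < cos \<alpha>" "0 < cos \<beta>" "0 < cos \<gamma>"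
proof -
  have "(\<rho> + \<sigma> / 2) / om < (\<sigma> / 2) / om" "(\<sigma> / 2) / om < q"
    unfolding q_def using rho_neg l_pos by (intro divide_strict_right_mono; simp)+
  then show "\<alpha> < \<gamma>" "\<gamma> < \<beta>"
    unfolding \<alpha>_def \<beta>_def \<gamma>_def by (simp_all only: arctan_less_iff)
qed (unfold \<alpha>_def \<beta>_def \<gamma>_def, (rule arctan_lbound arctan_ubound cos_arctan_not_zero |
  simp add: cos_arctan add_pos_nonneg)+)

lemma tan_beta: "q = sin \<beta> / cos \<beta>"
  unfolding \<beta>_def by (metis tan_arctan tan_def)

lemma tan_gamma: "(\<sigma> / 2) / om = sin \<gamma> / cos \<gamma>"
  unfolding \<gamma>_def by (metis tan_arctan tan_def)

lemmas polar = osc_polar[of \<sigma> \<rho>, folded \<alpha>_def]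

lemma Tc_eq: "om * Tc = pi + \<alpha> - \<beta>"
  unfolding transit_time_def \<alpha>_def \<beta>_def q_def by simp

lemma Tc_bounds: "0 < Tc" "Tc < 2 * pi / om"
proof -
  have "0 < om * Tc" "om * Tc < 2 * pi" unfolding Tc_eq using angles by linarith+
  then show "0 < Tc" "Tc < 2 * pi / om"
    using om_pos by (simp_all add: zero_less_mult_iff pos_less_divide_eq mult.commute)
qed

lemma Rc_pos: "0 < Rc"
  unfolding transit_ratio_def using quad_pos[OF sigma] by simp

lemma osc_Tc: "U Tc = - Rc" "V Tc = - q * Rc"
proof -
  have a: "om * Tc - \<alpha> = pi - \<beta>" unfolding Tc_eq by simp
  \<comment> \<open>The cosine of an arctangent is \<open>1 / sqrt (1 + p\<^sup>2)\<close>; the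
    factors 4/3 from completing the square cancel in the quotient.\<close>
  have cb: "cos \<beta> / cos \<alpha> = sqrt ((1 + \<sigma> * \<rho> + \<rho>\<^sup>2) / (1 + \<sigma> * l + l\<^sup>2))"
    unfolding \<alpha>_def \<beta>_def q_def cos_arctan one_plus_slope_sq[OF sigma]
    by (simp only: real_sqrt_divide real_sqrt_mult) simp
  show U: "U Tc = - Rc"
    unfolding polar a transit_ratio_def cb[symmetric] by simp
  have "V Tc = - (sin \<beta> / cos \<beta>) * (exp (- (\<sigma> * Tc / 2)) * (cos \<beta> / cos \<alpha>))"
    unfolding polar a using angles by simp
  also have "\<dots> = - q * Rc"
    unfolding tan_beta[symmetric] transit_ratio_def cb ..
  finally show "V Tc = - q * Rc" .
qed

text \<open>\<open>\<gamma>\<close> is the angle of the nullcline \<open>u' = 0\<close>, which the orbit does not meet before time \<open>Tc\<close>.\<close>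

lemma U'_neg:
  assumes "0 \<le> T" "T \<le> Tc"
  shows "om * V T - \<sigma> / 2 * U T < 0"
proof -
  define \<phi> where "\<phi> = om * T - \<alpha>"
  have "om * T \<le> om * Tc" "0 \<le> om * T"
    using assms om_pos by (simp_all add: less_imp_le)
  \<comment> \<open>The phase runs from \<open>- \<alpha>\<close> to \<open>pi - \<beta>\<close>,
    and \<open>\<alpha> < \<gamma> < \<beta>\<close>.\<close>
  then have "0 < \<phi> + \<gamma>" "\<phi> + \<gamma> < pi"
    unfolding \<phi>_def Tc_eq using angles by linarith+
  then have s: "0 < sin (\<phi> + \<gamma>)" by (rule sin_gt_zero)
  have g: "\<sigma> / 2 = om * (sin \<gamma> / cos \<gamma>)" by (simp flip: tan_gamma)
  have "om * V T - \<sigma> / 2 * U T = - (om * exp (- (\<sigma> * T / 2)) / (cos \<alpha> * cos \<gamma>) * sin (\<phi> + \<gamma>))"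
    unfolding polar \<phi>_def[symmetric] g sin_add using angles(7,9)
    by (simp add: field_simps)
  then show ?thesis using s angles by simp
qed

lemma U_strict_decreasing:
  assumes "0 \<le> T" "T < T'" "T' \<le> Tc"
  shows "U T' < U T"
proof (rule DERIV_neg_imp_decreasing[OF assms(2)])
  fix x assume "T \<le> x" "x \<le> T'"
  then have "om * V x - \<sigma> / 2 * U x < 0" using assms by (intro U'_neg) auto
  then show "\<exists>y. (U has_real_derivative y) (at x) \<and> y < 0"
    using osc_deriv(1) by blast
qed

text \<open>Being on the line of slope \<open>l\<close> means
  \<open>sin (\<phi> + \<beta>) = 0\<close>, so \<open>\<phi> + \<beta>\<close> is a multiple of
  \<open>pi\<close>. Within one turn only \<open>pi\<close> and \<open>2 * pi\<close> remain; the
  latter makes \<open>cos \<phi>\<close> positive, against \<open>U T < 0\<close>.\<close>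

lemma Tc_unique:
  assumes T: "0 < T" "T < 2 * pi / om" and U: "U T < 0" and V: "V T = q * U T"
  shows "T = Tc"
proof -
  define \<phi> where "\<phi> = om * T - \<alpha>"
  have "om * T > 0" "om * T < 2 * pi" using T om_pos by (simp_all add: pos_less_divide_eq mult.commute)
  then have b: "0 < \<phi> + \<beta>" "\<phi> + \<beta> < 3 * pi"
    unfolding \<phi>_def using angles by linarith+
  have c: "cos \<phi> < 0"
    using U angles(7) unfolding polar \<phi>_def[symmetric] by (simp add: mult_less_0_iff divide_less_0_iff)
  define e where "e = exp (- (\<sigma> * T / 2))"
  have "e * (- sin \<phi> / cos \<alpha>) = e * (q * (cos \<phi> / cos \<alpha>))" "e \<noteq> 0"
    using V unfolding polar \<phi>_def[symmetric] e_def by simp_all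
  then have "- sin \<phi> / cos \<alpha> = q * (cos \<phi> / cos \<alpha>)" by (simp only: mult_cancel_left) simp
  then have "- sin \<phi> = q * cos \<phi>" using angles by (simp add: field_simps)
  then have "sin (\<phi> + \<beta>) = 0"
    unfolding tan_beta sin_add using angles(8) by (simp add: field_simps)
  then obtain i :: int where i: "\<phi> + \<beta> = i * pi" unfolding sin_zero_iff_int2 by blast
  have "0 < i" "i < 3" using b pi_gt_zero unfolding i
    by (auto simp: zero_less_mult_iff)
  then consider "i = 1" | "i = 2" by linarith
  then show ?thesis
  proof cases
    case 1
    then have "om * T = om * Tc" unfolding Tc_eq using i \<phi>_def by simp
    then show ?thesis by simp
  next
    case 2
    then have "\<phi> = 2 * pi - \<beta>" using i by simp
    then have "cos \<phi> = cos \<beta>" by (simp add: cos_diff)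
    then show ?thesis using c angles by linarith
  qed
qed

end

section \<open>Orbits of the piecewise linear system\<close>

text \<open>The filter at \<open>t\<close> within the union is the supremum of those within the two
  pieces. If \<open>t\<close> lies outside a piece, the filter of that piece is trivial and the
  derivative claim there is vacuous.\<close>

lemma has_real_derivative_glue:
  fixes f g :: "real \<Rightarrow> real"
  assumes t: "t \<in> {a..c}" and b: "a \<le> b" "b \<le> c" and fg: "f b = g b"
    and f: "t \<le> b \<Longrightarrow> (f has_real_derivative D) (at t within {a..b})"
    and g: "b \<le> t \<Longrightarrow> (g has_real_derivative D) (at t within {b..c})"
  shows "((\<lambda>t. if t \<le> b then f t else g t) has_real_derivative D) (at t within {a..c})"
proof -
  let ?h = "\<lambda>t. if t \<le> b then f t else g t"
  have "(?h has_real_derivative D) (at t within {a..b})"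
  proof (cases "t \<le> b")
    case True
    show ?thesis
      by (rule has_field_derivative_transform_within[OF f[OF True], of 1]) (use True t in auto)
  next
    case False
    then have "at t within {a..b} = bot" by (intro not_in_closure_trivial_limitI) auto
    then show ?thesis by (simp add: has_field_derivative_iff)
  qed
  moreover have "(?h has_real_derivative D) (at t within {b..c})"
  proof (cases "b \<le> t")
    case True
    show ?thesis
      by (rule has_field_derivative_transform_within[OF g[OF True], of 1]) (use True t fg in auto)
  next
    case False
    then have "at t within {b..c} = bot" by (intro not_in_closure_trivial_limitI) auto
    then show ?thesis by (simp add: has_field_derivative_iff)
  qed
  moreover have "{a..c} = {a..b} \<union> {b..c}" using b by auto
  ultimately show ?thesis by (simp add: has_field_derivative_iff Lim_within_Un)
qed

lemma pwl_solution_glue: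
  assumes z1: "pwl_solution a k m \<epsilon> z1 {t0..t1}" and z2: "pwl_solution a k m \<epsilon> z2 {t1..t2}"
    and t: "t0 \<le> t1" "t1 \<le> t2" and eq: "z1 t1 = z2 t1"
  shows "pwl_solution a k m \<epsilon> (\<lambda>t. if t \<le> t1 then z1 t else z2 t) {t0..t2}"
  unfolding pwl_solution_def
proof (intro ballI conjI)
  fix u assume u: "u \<in> {t0..t2}"
  have F: "(\<lambda>t. fst (if t \<le> t1 then z1 t else z2 t)) = (\<lambda>t. if t \<le> t1 then fst (z1 t) else fst (z2 t))"
    and S: "(\<lambda>t. snd (if t \<le> t1 then z1 t else z2 t)) = (\<lambda>t. if t \<le> t1 then snd (z1 t) else snd (z2 t))"
    by auto
  have v: "(if u \<le> t1 then z1 u else z2 u) = z2 u" if "t1 \<le> u"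
    using that eq by (cases "u = t1") auto
  show "((\<lambda>t. fst (if t \<le> t1 then z1 t else z2 t)) has_real_derivative
        snd (if u \<le> t1 then z1 u else z2 u) - pwl_f (fst (if u \<le> t1 then z1 u else z2 u)) a k m \<epsilon>)
       (at u within {t0..t2})"
    unfolding F
  proof (rule has_real_derivative_glue[OF u t])
    show "((\<lambda>t. fst (z1 t)) has_real_derivative
        snd (if u \<le> t1 then z1 u else z2 u) - pwl_f (fst (if u \<le> t1 then z1 u else z2 u)) a k m \<epsilon>)
       (at u within {t0..t1})" if "u \<le> t1"
      using z1 that u unfolding pwl_solution_def by simp
    show "((\<lambda>t. fst (z2 t)) has_real_derivative
        snd (if u \<le> t1 then z1 u else z2 u) - pwl_f (fst (if u \<le> t1 then z1 u else z2 u)) a k m \<epsilon>)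
       (at u within {t1..t2})" if "t1 \<le> u"
      unfolding v[OF that] using z2 that u unfolding pwl_solution_def by simp
  qed (use eq in simp)
  show "((\<lambda>t. snd (if t \<le> t1 then z1 t else z2 t)) has_real_derivative
        \<epsilon> * (a - fst (if u \<le> t1 then z1 u else z2 u))) (at u within {t0..t2})"
    unfolding S
  proof (rule has_real_derivative_glue[OF u t])
    show "((\<lambda>t. snd (z1 t)) has_real_derivative
        \<epsilon> * (a - fst (if u \<le> t1 then z1 u else z2 u))) (at u within {t0..t1})" if "u \<le> t1"
      using z1 that u unfolding pwl_solution_def by simp
    show "((\<lambda>t. snd (z2 t)) has_real_derivative
        \<epsilon> * (a - fst (if u \<le> t1 then z1 u else z2 u))) (at u within {t1..t2})" if "t1 \<le> u"
      unfolding v[OF that] using z2 that u unfolding pwl_solution_def by simp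
  qed (use eq in simp)
qed

lemma pwl_f_band:
  assumes "\<bar>x\<bar> \<le> s" "s \<le> 1"
  shows "pwl_f x a k m (s\<^sup>2) = m * (x - a)"
\<comment> \<open>At \<open>x = - s\<close> the definition selects the formula of the left zone,
  which takes the same value there.\<close>
proof (cases "x = - s")
  case True
  then show ?thesis using assms by (simp add: pwl_f_def algebra_simps)
next
  case False
  then show ?thesis using assms by (auto simp: pwl_f_def)
qed

text \<open>At \<open>x = s\<close> the definition uses the central formula, whose value
  \<open>m * (s - a)\<close> is the one given here; so the whole closed half-line obeys one linear
  law.\<close>

lemma pwl_f_right:
  assumes "s \<le> x" "0 < s"
  shows "pwl_f x a k m (s\<^sup>2) = x - s + m * (s - a)"
  using assms by (auto simp: pwl_f_def)

text \<open>Here \<open>s\<close> is \<open>sqrt \<epsilon>\<close>. The bounds on \<open>s\<close>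
  make both radicands \<open>1 - 4 * s\<^sup>2\<close> and \<open>k\<^sup>2 - 4 * s\<^sup>2\<close>
  positive. Dividing the slow eigenvalues by \<open>s\<close> expresses them in the rescaled
  time.\<close>

locale canard =
  fixes \<sigma> s k :: real
  assumes abs_sigma: "\<bar>\<sigma>\<bar> = 1" and s: "0 < s" "s < 1/2" "2 * s < k"
begin

abbreviation "\<rho> \<equiv> lambda_R (s\<^sup>2) / s"
abbreviation "l \<equiv> lambda_L k (s\<^sup>2) / s"

lemma sigma_sq: "\<sigma> * \<sigma> = 1"
  using abs_sigma by (metis abs_mult_self_eq mult_1)

lemma lambda_R_neg: "lambda_R (s\<^sup>2) < 0"
proof -
  have "sqrt (1 - 4 * s\<^sup>2) < sqrt 1" using s by (intro real_sqrt_less_mono) auto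
  then show ?thesis by (simp add: lambda_R_def)
qed

lemma lambda_R_eq: "lambda_R (s\<^sup>2) * lambda_R (s\<^sup>2) + lambda_R (s\<^sup>2) + s\<^sup>2 = 0"
proof -
  have "s\<^sup>2 \<le> (1/2)\<^sup>2" using s by (intro power_mono) auto
  then have "sqrt (1 - 4 * s\<^sup>2) * sqrt (1 - 4 * s\<^sup>2) = 1 - 4 * s\<^sup>2" by (simp add: power_divide)
  then show ?thesis unfolding lambda_R_def by (simp add: field_simps)
qed

lemma four_s_sq: "4 * s\<^sup>2 < k\<^sup>2"
proof -
  have "(2 * s)\<^sup>2 < k\<^sup>2" using s by (intro power_strict_mono) auto
  then show ?thesis by (simp add: power_mult_distrib)
qed

lemma lambda_L_pos: "0 < lambda_L k (s\<^sup>2)"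
proof -
  have "sqrt (k\<^sup>2 - 4 * s\<^sup>2) < sqrt (k\<^sup>2)" using s by (intro real_sqrt_less_mono) auto
  then show ?thesis using s by (simp add: lambda_L_def)
qed

sublocale transit \<sigma> \<rho> l
  using abs_sigma s lambda_R_neg lambda_L_pos
  by unfold_locales (auto simp: divide_neg_pos)

lemma om_sq': "om * (om * x) = 3/4 * x"
  using om_sq by (simp add: power2_eq_square flip: mult.assoc)

lemma sigma_sq': "\<sigma> * (\<sigma> * x) = x"
  using sigma_sq by (simp flip: mult.assoc)

text \<open>In the band the field is linear, and the point \<open>q1_R\<close> has oscillator
  coordinates \<open>s - a\<close> times those of \<open>U\<close> and \<open>V\<close> at time 0.
  The deviation from the explicit solution therefore solves the homogeneous system with zero initial
  value.\<close>

lemma central_flow_unique: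
  assumes z: "pwl_solution a k (\<sigma> * s) (s\<^sup>2) z I" "{t0..t1} \<subseteq> I"
    and band: "\<And>t. t \<in> {t0..t1} \<Longrightarrow> \<bar>fst (z t)\<bar> \<le> s"
    and init: "z t0 = q1_R a (\<sigma> * s) (s\<^sup>2)" and t: "t \<in> {t0..t1}"
  shows "fst (z t) = a + (s - a) * U (s * (t - t0))"
    and "snd (z t) = s * (s - a) * (om * V (s * (t - t0)) + \<sigma> / 2 * U (s * (t - t0)))"
proof -
  \<comment> \<open>The conjugate coordinate \<open>(u' + \<sigma> / 2 * u) / om\<close> in the
    original variables, since \<open>u' = y / s - \<sigma> * u\<close> in rescaled time.\<close>
  define v where "v t = (snd (z t) / s - \<sigma> / 2 * (fst (z t) - a)) / om" for t
  define D1 where "D1 t = fst (z t) - a - (s - a) * U (s * (t - t0))" for t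
  define D2 where "D2 t = v t - (s - a) * V (s * (t - t0))" for t
  have y: "snd (z t) = s * (om * v t + \<sigma> / 2 * (fst (z t) - a))" for t
    unfolding v_def using s by simp
  have dU: "((\<lambda>t. U (s * (t - t0))) has_real_derivative
      (om * V (s * (t - t0)) - \<sigma> / 2 * U (s * (t - t0))) * s) (at t within A)" for t A
    by (rule DERIV_chain2[OF osc_deriv(1)]) (auto intro!: derivative_eq_intros)
  have dV: "((\<lambda>t. V (s * (t - t0))) has_real_derivative
      (- om * U (s * (t - t0)) - \<sigma> / 2 * V (s * (t - t0))) * s) (at t within A)" for t A
    by (rule DERIV_chain2[OF osc_deriv(2)]) (auto intro!: derivative_eq_intros)
  have d: "(D1 has_real_derivative s * (om * D2 t - \<sigma> / 2 * D1 t)) (at t within {t0..t1})"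
    "(D2 has_real_derivative s * (- om * D1 t - \<sigma> / 2 * D2 t)) (at t within {t0..t1})"
    if t: "t \<in> {t0..t1}" for t
  proof -
    have f: "pwl_f (fst (z t)) a k (\<sigma> * s) (s\<^sup>2) = \<sigma> * s * (fst (z t) - a)"
      by (rule pwl_f_band[OF band[OF t]]) (use s in simp)
    have x': "((\<lambda>t. fst (z t)) has_real_derivative s * (om * v t - \<sigma> / 2 * (fst (z t) - a)))
        (at t within {t0..t1})"
    proof -
      have "((\<lambda>t. fst (z t)) has_real_derivative
          snd (z t) - pwl_f (fst (z t)) a k (\<sigma> * s) (s\<^sup>2)) (at t within {t0..t1})"
        using z t unfolding pwl_solution_def by (blast intro: DERIV_subset)
      also have "snd (z t) - pwl_f (fst (z t)) a k (\<sigma> * s) (s\<^sup>2)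
          = s * (om * v t - \<sigma> / 2 * (fst (z t) - a))"
        unfolding f y by (simp add: algebra_simps)
      finally show ?thesis .
    qed
    have y': "((\<lambda>t. snd (z t)) has_real_derivative s\<^sup>2 * (a - fst (z t))) (at t within {t0..t1})"
      using z t unfolding pwl_solution_def by (blast intro: DERIV_subset)
    have v': "(v has_real_derivative s * (- om * (fst (z t) - a) - \<sigma> / 2 * v t)) (at t within {t0..t1})"
    proof -
      have "(v has_real_derivative (s\<^sup>2 * (a - fst (z t)) / s
          - \<sigma> / 2 * (s * (om * v t - \<sigma> / 2 * (fst (z t) - a)))) / om) (at t within {t0..t1})"
        unfolding v_def[abs_def] using x'[unfolded v_def] y' s by (auto intro!: derivative_eq_intros)
      also have "(s\<^sup>2 * (a - fst (z t)) / s
          - \<sigma> / 2 * (s * (om * v t - \<sigma> / 2 * (fst (z t) - a)))) / om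
          = s * (- om * (fst (z t) - a) - \<sigma> / 2 * v t)"
      proof -
        have "s\<^sup>2 * (a - fst (z t)) / s = s * (a - fst (z t))"
          using s by (simp add: power2_eq_square)
        moreover have "s * (- x) - \<sigma> / 2 * (s * (om * w - \<sigma> / 2 * x))
            = om * (s * (- om * x - \<sigma> / 2 * w))" for x w
          by (simp add: algebra_simps om_sq' sigma_sq')
        from this[of "fst (z t) - a" "v t"]
        have "s * (a - fst (z t)) - \<sigma> / 2 * (s * (om * v t - \<sigma> / 2 * (fst (z t) - a)))
          = om * (s * (- om * (fst (z t) - a) - \<sigma> / 2 * v t))"
          by (simp only: minus_diff_eq)
        ultimately show ?thesis by simp
      qed
      finally show ?thesis .
    qed
    show "(D1 has_real_derivative s * (om * D2 t - \<sigma> / 2 * D1 t)) (at t within {t0..t1})"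
      unfolding D1_def[abs_def] D2_def
      by (rule derivative_eq_intros x' dU refl)+ (simp add: field_simps)
    show "(D2 has_real_derivative s * (- om * D1 t - \<sigma> / 2 * D2 t)) (at t within {t0..t1})"
      unfolding D2_def[abs_def] D1_def
      by (rule derivative_eq_intros v' dV refl)+ (simp add: field_simps)
  qed
  \<comment> \<open>Uniqueness: the squared distance of two solutions decays exactly like \<open>exp (- \<sigma> * s * t)\<close>.\<close>
  define E where "E t = exp (\<sigma> * s * t) * (D1 t * D1 t + D2 t * D2 t)" for t
  have "(E has_real_derivative 0) (at t within {t0..t1})" if "t \<in> {t0..t1}" for t
    unfolding E_def[abs_def]
    by (rule derivative_eq_intros d[OF that] refl)+ (simp add: algebra_simps)
  then obtain c where c: "\<And>t. t \<in> {t0..t1} \<Longrightarrow> E t = c"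
    using has_field_derivative_zero_constant[of "{t0..t1}" E] by auto
  have "fst (z t0) = s" "snd (z t0) = (\<sigma> * s + lambda_R (s\<^sup>2)) * (s - a)"
    using init s by (simp_all add: q1_R_def)
  moreover have "(\<sigma> * s + lambda_R (s\<^sup>2)) * (s - a) / s - \<sigma> / 2 * (s - a) = (s - a) * (\<rho> + \<sigma> / 2)"
    using s by (simp add: field_simps)
  ultimately have "D1 t0 = 0" "D2 t0 = 0"
    unfolding D1_def D2_def v_def by (simp_all add: osc_0)
  then have "E t0 = 0" by (simp add: E_def)
  then have "E t = 0" using c[OF t] c[of t0] t by simp
  then have "D1 t = 0" "D2 t = 0" unfolding E_def by (simp_all add: sum_squares_eq_zero_iff)
  then have xv: "fst (z t) - a = (s - a) * U (s * (t - t0))" "v t = (s - a) * V (s * (t - t0))"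
    unfolding D1_def D2_def by simp_all
  from xv(1) show "fst (z t) = a + (s - a) * U (s * (t - t0))" by simp
  show "snd (z t) = s * (s - a) * (om * V (s * (t - t0)) + \<sigma> / 2 * U (s * (t - t0)))"
    unfolding y xv by (simp add: field_simps)
qed

lemma central_flow_solution:
  assumes band: "\<And>t. t \<in> {t0..t1} \<Longrightarrow> \<bar>a + (s - a) * U (s * (t - t0))\<bar> \<le> s"
  shows "pwl_solution a k (\<sigma> * s) (s\<^sup>2)
    (\<lambda>t. (a + (s - a) * U (s * (t - t0)),
      s * (s - a) * (om * V (s * (t - t0)) + \<sigma> / 2 * U (s * (t - t0))))) {t0..t1}"
  unfolding pwl_solution_def fst_conv snd_conv
proof (intro ballI conjI)
  fix t assume t: "t \<in> {t0..t1}"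
  have dU: "((\<lambda>t. U (s * (t - t0))) has_real_derivative
      (om * V (s * (t - t0)) - \<sigma> / 2 * U (s * (t - t0))) * s) (at t within A)" for t A
    by (rule DERIV_chain2[OF osc_deriv(1)]) (auto intro!: derivative_eq_intros)
  have dV: "((\<lambda>t. V (s * (t - t0))) has_real_derivative
      (- om * U (s * (t - t0)) - \<sigma> / 2 * V (s * (t - t0))) * s) (at t within A)" for t A
    by (rule DERIV_chain2[OF osc_deriv(2)]) (auto intro!: derivative_eq_intros)
  have f: "pwl_f (a + (s - a) * U (s * (t - t0))) a k (\<sigma> * s) (s\<^sup>2) = \<sigma> * s * ((s - a) * U (s * (t - t0)))"
    using pwl_f_band[OF band[OF t]] s by simp
  show "((\<lambda>t. a + (s - a) * U (s * (t - t0))) has_real_derivative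
      s * (s - a) * (om * V (s * (t - t0)) + \<sigma> / 2 * U (s * (t - t0))) -
      pwl_f (a + (s - a) * U (s * (t - t0))) a k (\<sigma> * s) (s\<^sup>2)) (at t within {t0..t1})"
    unfolding f by (rule derivative_eq_intros dU refl)+ (simp add: algebra_simps)
  show "((\<lambda>t. s * (s - a) * (om * V (s * (t - t0)) + \<sigma> / 2 * U (s * (t - t0)))) has_real_derivative
      s\<^sup>2 * (a - (a + (s - a) * U (s * (t - t0))))) (at t within {t0..t1})"
    by (rule derivative_eq_intros dU dV refl)+
       (simp add: algebra_simps power2_eq_square om_sq' sigma_sq')
qed

text \<open>As \<open>v_R\<close> is an eigenvector of the right linear system, the flow along the
  slow manifold only multiplies the parameter \<open>r\<close> by
  \<open>exp (lambda_R (s\<^sup>2) * t)\<close>. The assumption keeps the orbit in the right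
  zone.\<close>

lemma slow_flow_solution:
  assumes r: "\<And>t. t \<in> {t0..t1} \<Longrightarrow> s \<le> a - r * exp (lambda_R (s\<^sup>2) * t) * lambda_R (s\<^sup>2)"
  shows "pwl_solution a k m (s\<^sup>2)
    (\<lambda>t. e_R a m (s\<^sup>2) - (r * exp (lambda_R (s\<^sup>2) * t)) *\<^sub>R v_R (s\<^sup>2)) {t0..t1}"
proof -
  let ?l = "lambda_R (s\<^sup>2)"
  have z: "e_R a m (s\<^sup>2) - (r * exp (?l * t)) *\<^sub>R v_R (s\<^sup>2) =
      (a - r * exp (?l * t) * ?l, (m - 1) * (s - a) + r * exp (?l * t) * s\<^sup>2)" for t
    using s by (simp add: e_R_def v_R_def)
  have l: "?l * (?l * x) = - ?l * x - s\<^sup>2 * x" for x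
  proof -
    have "?l * ?l = - ?l - s\<^sup>2" using lambda_R_eq by linarith
    then show ?thesis by (metis left_diff_distrib mult.assoc)
  qed
  show ?thesis
    unfolding z pwl_solution_def fst_conv snd_conv
  proof (intro ballI conjI)
    fix t assume t: "t \<in> {t0..t1}"
    have "((\<lambda>t. a - r * exp (?l * t) * ?l) has_real_derivative
        - (r * (exp (?l * t) * ?l) * ?l)) (at t within {t0..t1})"
      by (auto intro!: derivative_eq_intros)
    then show "((\<lambda>t. a - r * exp (?l * t) * ?l) has_real_derivative
        (m - 1) * (s - a) + r * exp (?l * t) * s\<^sup>2 - pwl_f (a - r * exp (?l * t) * ?l) a k m (s\<^sup>2))
        (at t within {t0..t1})"
      unfolding pwl_f_right[OF r[OF t] s(1)] by (simp add: algebra_simps l)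
    show "((\<lambda>t. (m - 1) * (s - a) + r * exp (?l * t) * s\<^sup>2) has_real_derivative
        s\<^sup>2 * (a - (a - r * exp (?l * t) * ?l))) (at t within {t0..t1})"
      by (auto intro!: derivative_eq_intros)
  qed
qed

text \<open>The end point imposes two conditions on the oscillator: a slope, which fixes the time
  once the sign of \<open>U T\<close> is known and full turns are excluded, and a value, which then
  fixes \<open>a\<close>. The exclusions all come from the orbit staying strictly inside the
  band.\<close>

lemma connects_from_imp:
  assumes "connects_from a k (\<sigma> * s) (s\<^sup>2) p \<tau>"
  shows "a = s * (Rc - 1) / (Rc + 1)" "\<tau> = Tc / s"
proof -
  from assms obtain z t0 where \<tau>: "0 < \<tau>" and t0: "0 \<le> t0"
    and sol: "pwl_solution a k (\<sigma> * s) (s\<^sup>2) z {0..t0 + \<tau>}"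
    and init: "z t0 = q1_R a (\<sigma> * s) (s\<^sup>2)"
    and band: "\<And>t. t0 < t \<Longrightarrow> t < t0 + \<tau> \<Longrightarrow> \<bar>fst (z t)\<bar> < s"
    and fin: "z (t0 + \<tau>) = q0_L a k (\<sigma> * s) (s\<^sup>2)"
    using s unfolding connects_from_def by auto
  have fin': "fst (z (t0 + \<tau>)) = - s" "snd (z (t0 + \<tau>)) = - (\<sigma> * s + lambda_L k (s\<^sup>2)) * (s + a)"
    using s unfolding fin by (simp_all add: q0_L_def)
  have init': "fst (z t0) = s" using s unfolding init by (simp add: q1_R_def)
  have "\<bar>fst (z t)\<bar> \<le> s" if "t \<in> {t0..t0 + \<tau>}" for t
    using band[of t] that fin'(1) init' s by (cases "t = t0 \<or> t = t0 + \<tau>") auto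
  note flow = central_flow_unique[OF sol _ this init]
  define T where "T = s * \<tau>"
  have T: "0 < T" using s \<tau> by (simp add: T_def)
  have sub: "{t0..t0 + \<tau>} \<subseteq> {0..t0 + \<tau>}" using t0 by auto
  have inside: "\<bar>a + (s - a) * U T'\<bar> < s" if "0 < T'" "T' < T" for T'
  proof -
    have t: "t0 < t0 + T' / s" "t0 + T' / s < t0 + \<tau>"
      using that s by (auto simp: T_def field_simps)
    then have "fst (z (t0 + T' / s)) = a + (s - a) * U T'"
      using flow(1)[OF sub, of "t0 + T' / s"] s by simp
    with band[OF t] show ?thesis by simp
  qed
  have "- s = a + (s - a) * U T"
    using flow(1)[OF sub, of "t0 + \<tau>"] fin' \<tau> by (simp add: T_def)
  then have UT: "(s - a) * U T = - (s + a)" by linarith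
  \<comment> \<open>The second coordinate of \<open>q0_L\<close> says that the end point lies on the
    line \<open>u' = l * u\<close>.\<close>
  have VT: "(s - a) * V T = q * ((s - a) * U T)"
  proof -
    have "- (\<sigma> * s + lambda_L k (s\<^sup>2)) * (s + a) = s * (s - a) * (om * V T + \<sigma> / 2 * U T)"
      using flow(2)[OF sub, of "t0 + \<tau>"] fin' \<tau> by (simp add: T_def)
    also have "\<dots> = s * (om * ((s - a) * V T) + \<sigma> / 2 * ((s - a) * U T))"
      by (simp add: field_simps)
    finally have "om * ((s - a) * V T) = (l + \<sigma> / 2) * ((s - a) * U T)"
      unfolding UT using s by (simp add: field_simps)
    then show ?thesis unfolding q_def by (simp add: field_simps)
  qed
  \<comment> \<open>For \<open>a = s\<close> the orbit would rest at \<open>x = s\<close>, on the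
    boundary of the band.\<close>
  have "s \<noteq> a" using inside[of "T / 2"] T s by auto
  moreover have "\<not> s < a"
  proof
    assume sa: "s < a"
    \<comment> \<open>For \<open>s < a\<close> the decrease of \<open>U\<close> pushes
      \<open>x\<close> beyond \<open>s\<close> at once; \<open>T'\<close> is a time inside the
      flight where this decrease is known.\<close>
    define T' where "T' = min (T / 2) Tc"
    have T': "0 < T'" "T' < T" "T' \<le> Tc" using T Tc_bounds by (auto simp: T'_def)
    then have "U T' < 1" using U_strict_decreasing[of 0 T'] by (simp add: osc_0)
    then have "(s - a) * 1 < (s - a) * U T'" using sa by (intro mult_strict_left_mono_neg) auto
    then show False using inside[OF T'(1,2)] by simp
  qed
  ultimately have sa: "0 < s - a" by simp
  have V: "V T = q * U T" using VT sa by simp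
  have U0: "U T \<noteq> 0"
  proof
    assume "U T = 0"
    then have "cos (om * T - \<alpha>) = 0" "sin (om * T - \<alpha>) = 0"
      using V angles unfolding polar by simp_all
    then show False using sin_cos_squared_add[of "om * T - \<alpha>"] by simp
  qed
  have U: "U T < 0"
  proof (rule ccontr)
    assume "\<not> U T < 0"
    with U0 have "0 < U T" by simp
    \<comment> \<open>On the line of slope \<open>l\<close> the derivative of \<open>U\<close> is
      \<open>l * U T\<close>. If this were positive, \<open>x\<close> would be below
      \<open>- s\<close> shortly before the end.\<close>
    moreover have "om * V T - \<sigma> / 2 * U T = l * U T"
      unfolding V q_def by (simp add: field_simps)
    ultimately have "0 < om * V T - \<sigma> / 2 * U T" using mult_pos_pos[OF l_pos] by metis
    from DERIV_pos_inc_left[OF osc_deriv(1) this]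
    obtain d where d: "0 < d" "\<And>h. 0 < h \<Longrightarrow> h < d \<Longrightarrow> U (T - h) < U T" by blast
    define h where "h = min (d / 2) (T / 2)"
    have h: "0 < h" "h < d" "h < T" using d(1) T by (auto simp: h_def)
    have "(s - a) * U (T - h) < (s - a) * U T"
      using d(2)[OF h(1,2)] sa by (intro mult_strict_left_mono)
    then show False using inside[of "T - h"] h UT by simp
  qed
  have "T < 2 * pi / om"
  proof (rule ccontr)
    assume neg: "\<not> T < 2 * pi / om"
    define P where "P = 2 * pi / om"
    have P: "0 < P" by (simp add: P_def)
    have "U P = exp (- (\<sigma> * pi / om))"
      using osc_shift[of \<sigma> \<rho> 0] by (simp add: osc_0 P_def)
    then have UP: "0 < U P" "\<sigma> = - 1 \<Longrightarrow> 1 < U P" by simp_all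
    have "T \<noteq> P" using UP U by auto
    with neg have PT: "P < T" by (simp add: P_def)
    show False
    \<comment> \<open>For a contracting spiral, one turn before the end \<open>U\<close> is more
      negative, so \<open>x\<close> is below \<open>- s\<close>. For an expanding one,
      \<open>U\<close> exceeds 1 after the first turn, so \<open>x\<close> is above
      \<open>s\<close>.\<close>
    proof (cases "\<sigma> = 1")
      case True
      have "U T = exp (- (pi / om)) * U (T - P)"
        using osc_shift[of \<sigma> \<rho> "T - P"] True by (simp add: P_def)
      then have "U (T - P) = exp (pi / om) * U T" by (simp add: exp_minus)
      also have "\<dots> < 1 * U T" using U by (intro mult_strict_right_mono_neg) auto
      finally have "(s - a) * U (T - P) < (s - a) * U T"
        using sa by (intro mult_strict_left_mono) auto
      then show False using inside[of "T - P"] P PT UT by simp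
    next
      case False
      then have "1 < U P" using abs_sigma UP by (simp add: abs_if split: if_splits)
      then have "(s - a) * 1 < (s - a) * U P" using sa by (intro mult_strict_left_mono) auto
      then show False using inside[OF P PT] by simp
    qed
  qed
  then have T_eq: "T = Tc" using T U V by (intro Tc_unique)
  then show "\<tau> = Tc / s" using s by (simp add: T_def field_simps)
  have "(s - a) * Rc = s + a" using UT unfolding T_eq osc_Tc by simp
  then have "a * (Rc + 1) = s * (Rc - 1)" by (simp add: algebra_simps)
  then show "a = s * (Rc - 1) / (Rc + 1)" using Rc_pos by (simp add: field_simps)
qed

text \<open>The orbit is assembled from the slide along \<open>mu_R\<close> to \<open>q1_R\<close>
  and the explicit oscillation. The choice of \<open>a\<close> means
  \<open>(s - a) * Rc = s + a\<close>, so the decrease of \<open>U\<close> from 1 to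
  \<open>- Rc\<close> carries \<open>x\<close> from \<open>s\<close> exactly to
  \<open>- s\<close>.\<close>

lemma connects_from_canard:
  fixes a :: real
  assumes a: "a = s * (Rc - 1) / (Rc + 1)" and p: "p \<in> mu_R a (\<sigma> * s) (s\<^sup>2)"
  shows "connects_from a k (\<sigma> * s) (s\<^sup>2) p (Tc / s)"
proof -
  let ?l = "lambda_R (s\<^sup>2)" and ?m = "\<sigma> * s"
  have "a * (Rc + 1) = s * (Rc - 1)" using Rc_pos by (simp add: a)
  then have Rsa: "(s - a) * Rc = s + a" by (simp add: algebra_simps)
  have "s - a = 2 * s / (Rc + 1)" using Rc_pos by (simp add: a field_simps)
  then have sa: "0 < s - a" using s Rc_pos by simp
  \<comment> \<open>The parameter of \<open>q1_R\<close> on the half-line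
    \<open>mu_R\<close>.\<close>
  define r0 where "r0 = (a - s) / ?l"
  have r0: "0 < r0" "r0 * ?l = a - s"
    using sa lambda_R_neg by (simp_all add: r0_def divide_neg_neg)
  from p obtain r where r: "r0 \<le> r" and p_eq: "p = e_R a ?m (s\<^sup>2) - r *\<^sub>R v_R (s\<^sup>2)"
    using s unfolding mu_R_def r0_def by auto
  \<comment> \<open>The time at which the parameter has decayed from \<open>r\<close> to
    \<open>r0\<close>.\<close>
  define t0 where "t0 = ln (r / r0) / (- ?l)"
  have t0: "0 \<le> t0" using r r0 lambda_R_neg by (simp add: t0_def divide_nonneg_neg)
  have "?l * t0 = - ln (r / r0)" using lambda_R_neg by (simp add: t0_def)
  then have e0: "r * exp (?l * t0) = r0"
    using r r0 by (simp add: exp_minus)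
  define z1 where "z1 t = e_R a ?m (s\<^sup>2) - (r * exp (?l * t)) *\<^sub>R v_R (s\<^sup>2)" for t
  define z2 where "z2 t = (a + (s - a) * U (s * (t - t0)),
      s * (s - a) * (om * V (s * (t - t0)) + \<sigma> / 2 * U (s * (t - t0))))" for t
  define \<tau> where "\<tau> = Tc / s"
  have \<tau>: "0 < \<tau>" "s * \<tau> = Tc" using Tc_bounds s by (simp_all add: \<tau>_def)
  have U_mono: "- Rc \<le> U T \<and> U T \<le> 1 \<and> (0 < T \<longrightarrow> T < Tc \<longrightarrow> - Rc < U T \<and> U T < 1)"
    if "0 \<le> T" "T \<le> Tc" for T
    using U_strict_decreasing[of 0 T] U_strict_decreasing[of T Tc] that osc_Tc(1) osc_0(1)[of \<sigma> \<rho>]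
    by (cases "T = 0"; cases "T = Tc") auto
  have time: "0 \<le> s * (t - t0)" "s * (t - t0) \<le> Tc" if "t \<in> {t0..t0 + \<tau>}" for t
    using that s mult_left_mono[of "t - t0" \<tau> s] by (auto simp: \<tau>(2))
  have band: "\<bar>a + (s - a) * U (s * (t - t0))\<bar> \<le> s" if "t \<in> {t0..t0 + \<tau>}" for t
  proof -
    have "(s - a) * - Rc \<le> (s - a) * U (s * (t - t0))" "(s - a) * U (s * (t - t0)) \<le> (s - a) * 1"
      using U_mono[OF time[OF that]] sa by (intro mult_left_mono; simp)+
    then show ?thesis using Rsa by (simp add: abs_le_iff)
  qed
  have band': "\<bar>a + (s - a) * U (s * (t - t0))\<bar> < s" if "t \<in> {t0<..<t0 + \<tau>}" for t
  proof -
    have "0 < s * (t - t0)" "s * (t - t0) < Tc"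
      using that s mult_strict_left_mono[of "t - t0" \<tau> s] by (auto simp: \<tau>(2))
    then have "- Rc < U (s * (t - t0))" "U (s * (t - t0)) < 1" using U_mono[of "s * (t - t0)"] by auto
    then have "(s - a) * - Rc < (s - a) * U (s * (t - t0))" "(s - a) * U (s * (t - t0)) < (s - a) * 1"
      using sa by (intro mult_strict_left_mono; simp)+
    then show ?thesis using Rsa by (simp add: abs_less_iff)
  qed
  have z1: "pwl_solution a k ?m (s\<^sup>2) z1 {0..t0}"
    unfolding z1_def
  proof (rule slow_flow_solution)
    fix t assume "t \<in> {0..t0}"
    then have "?l * t0 \<le> ?l * t" using lambda_R_neg by (intro mult_left_mono_neg) auto
    then have "r0 \<le> r * exp (?l * t)" unfolding e0[symmetric] using r r0 by (intro mult_left_mono) auto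
    then have "r * exp (?l * t) * ?l \<le> r0 * ?l" using lambda_R_neg by (intro mult_right_mono_neg) auto
    then show "s \<le> a - r * exp (?l * t) * ?l" using r0 by simp
  qed
  have z2: "pwl_solution a k ?m (s\<^sup>2) z2 {t0..t0 + \<tau>}"
    unfolding z2_def by (rule central_flow_solution[OF band])
  have z1_t0: "z1 t0 = q1_R a ?m (s\<^sup>2)"
  proof -
    have "s\<^sup>2 \<le> (1/2)\<^sup>2" using s by (intro power_mono) auto
    then have "4 * s\<^sup>2 \<le> 1" by (simp add: power_divide)
    moreover have "z1 t0 \<in> mu_R a ?m (s\<^sup>2)"
      unfolding z1_def e0 mu_R_def by (rule imageI) (use s in \<open>simp add: r0_def\<close>)
    moreover have "fst (z1 t0) = s"
      unfolding z1_def e0 using r0(2) by (simp add: e_R_def v_R_def)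
    ultimately show ?thesis using mu_R_inter_right_line[of "s\<^sup>2" a ?m] s by auto
  qed
  have z2_t0: "z2 t0 = q1_R a ?m (s\<^sup>2)"
    using s by (simp add: z2_def q1_R_def osc_0 field_simps)
  have z2_end: "z2 (t0 + \<tau>) = q0_L a k ?m (s\<^sup>2)"
  proof -
    have "s * (s - a) * (om * - (q * Rc) + \<sigma> / 2 * - Rc) = - (s * (om * q + \<sigma> / 2) * ((s - a) * Rc))"
      by (simp add: field_simps)
    also have "s * (om * q + \<sigma> / 2) = \<sigma> * s + lambda_L k (s\<^sup>2)"
      using s unfolding q_def by (simp add: field_simps)
    finally have "s * (s - a) * (om * - (q * Rc) + \<sigma> / 2 * - Rc) = - (\<sigma> * s + lambda_L k (s\<^sup>2)) * (s + a)"
      unfolding Rsa by (simp only: minus_mult_left)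
    moreover have "a + (s - a) * - Rc = - s" using Rsa by simp
    ultimately show ?thesis
      using s by (simp add: z2_def q0_L_def osc_Tc \<tau>(2))
  qed
  define z where "z t = (if t \<le> t0 then z1 t else z2 t)" for t
  have sol: "pwl_solution a k ?m (s\<^sup>2) z {0..t0 + \<tau>}"
    unfolding z_def using \<tau> t0 z1_t0 z2_t0 by (intro pwl_solution_glue z1 z2) auto
  have "s\<^sup>2 \<le> 1" using s by (intro power_le_one) auto
  with mu_L_inter_left_line[of "s\<^sup>2" k a ?m] four_s_sq s
  have muL: "q0_L a k ?m (s\<^sup>2) \<in> mu_L a k ?m (s\<^sup>2)" by auto
  have z0: "z 0 = p" using t0 by (simp add: z_def z1_def p_eq)
  have zt0: "z t0 = q1_R a ?m (s\<^sup>2)" using z1_t0 by (simp add: z_def)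
  have zend: "z (t0 + \<tau>) = q0_L a k ?m (s\<^sup>2)" using z2_end \<tau> by (simp add: z_def)
  have zband: "\<bar>fst (z t)\<bar> < sqrt (s\<^sup>2)" if "t \<in> {t0<..<t0 + \<tau>}" for t
    using band'[OF that] that s by (simp add: z_def z2_def)
  show ?thesis
    unfolding connects_from_def \<tau>_def[symmetric]
    using zend muL
    by (intro conjI exI[of _ z] exI[of _ t0] ballI \<tau>(1) p t0 sol z0 zt0 zend zband) simp_all
qed

end

section \<open>Expansions\<close>

text \<open>By the mean value theorem the increment is \<open>x * f' y\<close> with \<open>y\<close>
  between 0 and \<open>x\<close>; as \<open>y\<close> is nonzero, the bound on the punctured
  neighbourhood applies to it.\<close>

lemma integrate_bigo:
  fixes f :: "real \<Rightarrow> real"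
  assumes f: "\<And>x. (f has_real_derivative f' x) (at x)" and f': "f' \<in> O[at 0](\<lambda>x. x ^ n)"
  shows "(\<lambda>x. f x - f 0) \<in> O[at 0](\<lambda>x. x ^ Suc n)"
proof -
  from f' obtain C where C: "0 < C" "\<forall>\<^sub>F x in at 0. norm (f' x) \<le> C * norm (x ^ n)"
    by (elim landau_o.bigE)
  then obtain d where d: "0 < d" "\<And>x. x \<noteq> 0 \<Longrightarrow> \<bar>x\<bar> < d \<Longrightarrow> \<bar>f' x\<bar> \<le> C * \<bar>x\<bar> ^ n"
    unfolding eventually_at by (auto simp: dist_real_def power_abs)
  have "\<bar>f x - f 0\<bar> \<le> C * \<bar>x\<bar> ^ Suc n" if x: "x \<noteq> 0" "\<bar>x\<bar> < d" for x
  proof -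
    obtain y where y: "y \<noteq> 0" "\<bar>y\<bar> \<le> \<bar>x\<bar>" "f x - f 0 = x * f' y"
    proof (cases "0 < x")
      case True
      from MVT2[OF True, of f f'] f obtain y where "0 < y" "y < x" "f x - f 0 = (x - 0) * f' y" by blast
      then show ?thesis by (intro that[of y]) auto
    next
      case False
      with x have "x < 0" by simp
      from MVT2[OF this, of f f'] f obtain y where "x < y" "y < 0" "f 0 - f x = (0 - x) * f' y" by blast
      then show ?thesis by (intro that[of y]) auto
    qed
    have "\<bar>f' y\<bar> \<le> C * \<bar>y\<bar> ^ n" using d(2) y x by auto
    also have "\<dots> \<le> C * \<bar>x\<bar> ^ n" using C y by (intro mult_left_mono power_mono) auto
    finally have "\<bar>x\<bar> * \<bar>f' y\<bar> \<le> \<bar>x\<bar> * (C * \<bar>x\<bar> ^ n)" by (intro mult_left_mono) auto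
    then show ?thesis unfolding y(3) abs_mult by (simp add: mult_ac)
  qed
  then have "\<forall>\<^sub>F x in at 0. norm (f x - f 0) \<le> C * norm (x ^ Suc n)"
    unfolding eventually_at using d(1)
    by (intro exI[of _ d]) (auto simp: dist_real_def abs_mult power_abs)
  then show ?thesis by (rule landau_o.bigI[OF C(1)])
qed

text \<open>
  \<open>phiT\<close> and \<open>phiR\<close> carry the dependence of the flight time and of the logarithmic contraction ratio
  on one slope.  The latter vanishes to second order, so no \<open>\<epsilon>\<close> term occurs in the canard value.
\<close>

definition phiT :: "real \<Rightarrow> real \<Rightarrow> real" where
  "phiT \<sigma> x = arctan ((x + \<sigma> / 2) / om) / om"

definition phiR :: "real \<Rightarrow> real \<Rightarrow> real" where
  "phiR \<sigma> x = - (\<sigma> / 2) * phiT \<sigma> x + ln (1 + \<sigma> * x + x\<^sup>2) / 2"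

section \<open>Derivatives and Taylor expansions of the two angle functions\<close>

lemma phiT_deriv:
  assumes "\<bar>\<sigma>\<bar> = 1"
  shows "(phiT \<sigma> has_real_derivative 1 / (1 + \<sigma> * x + x\<^sup>2)) (at x)"
proof -
  have "((\<lambda>x. arctan ((x + \<sigma> / 2) / om) / om) has_real_derivative
      inverse (1 + ((x + \<sigma> / 2) / om)\<^sup>2) * (1 / om) / om) (at x)"
  proof -
    have "((\<lambda>x. (x + \<sigma> / 2) / om) has_real_derivative 1 / om) (at x)"
      by (intro DERIV_cdivide) (rule derivative_eq_intros refl | simp)+
    then have "((\<lambda>x. arctan ((x + \<sigma> / 2) / om)) has_real_derivative
        inverse (1 + ((x + \<sigma> / 2) / om)\<^sup>2) * (1 / om)) (at x)"
      by (rule DERIV_chain2[OF DERIV_arctan])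
    then show ?thesis by (rule DERIV_cdivide)
  qed
  also have "inverse (1 + ((x + \<sigma> / 2) / om)\<^sup>2) * (1 / om) / om
      = inverse (1 + ((x + \<sigma> / 2) / om)\<^sup>2) / om\<^sup>2"
    by (simp only: power2_eq_square[of om] times_divide_eq_right mult_1_right divide_divide_eq_left)
  also have "\<dots> = 1 / (1 + \<sigma> * x + x\<^sup>2)"
  proof -
    have "inverse (Q * (4/3)) / (3/4) = 1 / Q" for Q :: real by (simp add: field_simps)
    then show ?thesis unfolding one_plus_slope_sq[OF assms] om_sq .
  qed
  finally show ?thesis unfolding phiT_def[abs_def] .
qed

text \<open>The logarithm contributes
  \<open>(x + \<sigma> / 2) / (1 + \<sigma> * x + x\<^sup>2)\<close>, and the arctangent term
  removes the constant \<open>\<sigma> / 2\<close> from the numerator.\<close>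

lemma phiR_deriv:
  assumes "\<bar>\<sigma>\<bar> = 1"
  shows "(phiR \<sigma> has_real_derivative x / (1 + \<sigma> * x + x\<^sup>2)) (at x)"
proof -
  let ?Q = "1 + \<sigma> * x + x\<^sup>2"
  have "((\<lambda>x. 1 + \<sigma> * x + x\<^sup>2) has_real_derivative \<sigma> + 2 * x) (at x)"
    by (auto intro!: derivative_eq_intros)
  from DERIV_chain2[OF DERIV_ln[OF quad_pos[OF assms]] this]
  have "((\<lambda>x. ln (1 + \<sigma> * x + x\<^sup>2)) has_real_derivative inverse ?Q * (\<sigma> + 2 * x)) (at x)" .
  from DERIV_add[OF DERIV_cmult[OF phiT_deriv[OF assms], of "- (\<sigma> / 2)"] DERIV_cdivide[OF this, of 2]]
  have "(phiR \<sigma> has_real_derivative - (\<sigma> / 2) * (1 / ?Q) + inverse ?Q * (\<sigma> + 2 * x) / 2) (at x)"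
    unfolding phiR_def[abs_def] .
  also have "- (\<sigma> / 2) * (1 / Q) + inverse Q * (\<sigma> + 2 * x) / 2 = x / Q" for Q :: real
    by (cases "Q = 0") (auto simp: field_simps)
  finally show ?thesis .
qed

text \<open>The rational derivative is expanded first, and integration raises the order of the error
  by one.\<close>

lemma phiT_expansion:
  assumes "\<bar>\<sigma>\<bar> = 1"
  shows "(\<lambda>x. phiT \<sigma> x - phiT \<sigma> 0 - (x - \<sigma> * x\<^sup>2 / 2)) \<in> O[at 0](\<lambda>x. x ^ 3)"
proof -
  have "(\<lambda>x. 1 / (1 + \<sigma> * x + x\<^sup>2) - (1 - \<sigma> * x)) \<in> O[at 0](\<lambda>x. x ^ 2)"
  proof -
    have "\<sigma> = 1 \<or> \<sigma> = - 1" using assms by (auto simp: abs_if split: if_splits)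
    then show ?thesis by (elim disjE; hypsubst; real_asymp)
  qed
  then have "(\<lambda>x. (phiT \<sigma> x - (x - \<sigma> * x\<^sup>2 / 2)) - (phiT \<sigma> 0 - (0 - \<sigma> * 0\<^sup>2 / 2)))
      \<in> O[at 0](\<lambda>x. x ^ Suc 2)"
    by (rule integrate_bigo[rotated]) (auto intro!: derivative_eq_intros phiT_deriv assms)
  then show ?thesis by (simp add: numeral_3_eq_3 numeral_2_eq_2 algebra_simps)
qed

lemma phiR_expansion:
  assumes "\<bar>\<sigma>\<bar> = 1"
  shows "(\<lambda>x. phiR \<sigma> x - phiR \<sigma> 0 - x\<^sup>2 / 2) \<in> O[at 0](\<lambda>x. x ^ 3)"
proof -
  have "(\<lambda>x. x / (1 + \<sigma> * x + x\<^sup>2) - x) \<in> O[at 0](\<lambda>x. x ^ 2)"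
  proof -
    have "\<sigma> = 1 \<or> \<sigma> = - 1" using assms by (auto simp: abs_if split: if_splits)
    then show ?thesis by (elim disjE; hypsubst; real_asymp)
  qed
  then have "(\<lambda>x. (phiR \<sigma> x - x\<^sup>2 / 2) - (phiR \<sigma> 0 - 0\<^sup>2 / 2)) \<in> O[at 0](\<lambda>x. x ^ Suc 2)"
    by (rule integrate_bigo[rotated]) (auto intro!: derivative_eq_intros phiR_deriv assms)
  then show ?thesis by (simp add: numeral_3_eq_3 numeral_2_eq_2 algebra_simps)
qed

text \<open>The limit is in \<open>at 0\<close> because the expansions of \<open>phiT\<close> and
  \<open>phiR\<close> hold on a punctured neighbourhood. The square is estimated separately for use
  in their quadratic terms.\<close>

lemma slope_R_expansion:
  "filterlim (\<lambda>s. lambda_R (s\<^sup>2) / s) (at 0) (at_right 0)"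
  "(\<lambda>s. lambda_R (s\<^sup>2) / s) \<in> O[at_right 0](\<lambda>s. s)"
  "(\<lambda>s. lambda_R (s\<^sup>2) / s + s) \<in> O[at_right 0](\<lambda>s. s ^ 3)"
  "(\<lambda>s. (lambda_R (s\<^sup>2) / s)\<^sup>2 - s\<^sup>2) \<in> O[at_right 0](\<lambda>s. s ^ 3)"
  unfolding lambda_R_def by real_asymp+

text \<open>Scaling by \<open>k\<close> turns the left eigenvalue into the right one up to sign, so
  the finer expansions need no parameter.\<close>

lemma slope_L_eq_slope_R:
  assumes "0 < k" "0 < s"
  shows "lambda_L k (s\<^sup>2) / s = - (lambda_R ((s / k)\<^sup>2) / (s / k))"
proof -
  have "k\<^sup>2 - 4 * s\<^sup>2 = k\<^sup>2 * (1 - 4 * (s / k)\<^sup>2)" using assms by (simp add: field_simps)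
  then have "sqrt (k\<^sup>2 - 4 * s\<^sup>2) = k * sqrt (1 - 4 * (s / k)\<^sup>2)"
    using assms by (simp add: real_sqrt_mult)
  then show ?thesis using assms unfolding lambda_L_def lambda_R_def by (simp add: field_simps)
qed

lemma slope_L_expansion:
  assumes k: "0 < k"
  shows "filterlim (\<lambda>s. lambda_L k (s\<^sup>2) / s) (at 0) (at_right 0)"
    "(\<lambda>s. lambda_L k (s\<^sup>2) / s) \<in> O[at_right 0](\<lambda>s. s)"
    "(\<lambda>s. lambda_L k (s\<^sup>2) / s - s / k) \<in> O[at_right 0](\<lambda>s. s ^ 3)"
    "(\<lambda>s. (lambda_L k (s\<^sup>2) / s)\<^sup>2 - s\<^sup>2 / k\<^sup>2) \<in> O[at_right 0](\<lambda>s. s ^ 3)"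
proof -
  show "filterlim (\<lambda>s. lambda_L k (s\<^sup>2) / s) (at 0) (at_right 0)"
    "(\<lambda>s. lambda_L k (s\<^sup>2) / s) \<in> O[at_right 0](\<lambda>s. s)"
    unfolding lambda_L_def using assms by real_asymp+
  have lim: "filterlim (\<lambda>s. s / k) (at_right 0) (at_right 0)" using k by real_asymp
  have ev: "\<forall>\<^sub>F s in at_right 0. lambda_L k (s\<^sup>2) / s = - (lambda_R ((s / k)\<^sup>2) / (s / k))"
    using eventually_at_right_less[of 0] by eventually_elim (use slope_L_eq_slope_R[OF k] in blast)
  have cube: "(\<lambda>s. (s / k) ^ 3) \<in> O[at_right 0](\<lambda>s. s ^ 3)"
    using k by (simp add: power_divide)
  have "(\<lambda>s. - (lambda_R ((s / k)\<^sup>2) / (s / k) + s / k)) \<in> O[at_right 0](\<lambda>s. s ^ 3)"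
    using landau_o.big_trans[OF landau_o.big.compose[OF slope_R_expansion(3) lim] cube]
    by (simp only: landau_o.big.uminus_in_iff)
  also have "?this \<longleftrightarrow> (\<lambda>s. lambda_L k (s\<^sup>2) / s - s / k) \<in> O[at_right 0](\<lambda>s. s ^ 3)"
    by (rule landau_o.big.in_cong) (use ev in eventually_elim, simp)
  finally show "(\<lambda>s. lambda_L k (s\<^sup>2) / s - s / k) \<in> O[at_right 0](\<lambda>s. s ^ 3)" .
  have "(\<lambda>s. (lambda_R ((s / k)\<^sup>2) / (s / k))\<^sup>2 - (s / k)\<^sup>2) \<in> O[at_right 0](\<lambda>s. s ^ 3)"
    using landau_o.big_trans[OF landau_o.big.compose[OF slope_R_expansion(4) lim] cube] .
  also have "?this \<longleftrightarrow> (\<lambda>s. (lambda_L k (s\<^sup>2) / s)\<^sup>2 - s\<^sup>2 / k\<^sup>2) \<in> O[at_right 0](\<lambda>s. s ^ 3)"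
    by (rule landau_o.big.in_cong) (use ev in eventually_elim, simp add: power_divide)
  finally show "(\<lambda>s. (lambda_L k (s\<^sup>2) / s)\<^sup>2 - s\<^sup>2 / k\<^sup>2) \<in> O[at_right 0](\<lambda>s. s ^ 3)" .
qed

text \<open>A first-order Taylor formula: \<open>2 * E / (E + 1)\<^sup>2\<close> is the derivative
  at 0. It is stated in \<open>nhds 0\<close> because the function substituted for \<open>d\<close>
  is not known to avoid 0.\<close>

lemma mobius_exp_expansion:
  fixes E :: real
  assumes E: "0 < E"
  shows "(\<lambda>d. (E * exp d - 1) / (E * exp d + 1) - (E - 1) / (E + 1) - 2 * E / (E + 1)\<^sup>2 * d)
    \<in> O[nhds 0](\<lambda>d. d\<^sup>2)" (is "?f \<in> _")
proof -
  have "(\<lambda>d. 2 * E / ((E + 1)\<^sup>2 * (E * exp d + 1))) \<in> O[at 0](\<lambda>_. 1)"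
  proof (rule bigoI, rule always_eventually, rule allI)
    fix d
    have pos: "0 < E * exp d + 1" "0 < (E + 1)\<^sup>2" using E by (auto intro: add_pos_pos)
    have "(E + 1)\<^sup>2 * 1 \<le> (E + 1)\<^sup>2 * (E * exp d + 1)" using E by (intro mult_left_mono) auto
    then have "2 * E / ((E + 1)\<^sup>2 * (E * exp d + 1)) \<le> 2 * E / ((E + 1)\<^sup>2 * 1)"
      using E pos by (intro divide_left_mono mult_pos_pos) auto
    moreover have "0 \<le> 2 * E / ((E + 1)\<^sup>2 * (E * exp d + 1))" using E by simp
    ultimately show "norm (2 * E / ((E + 1)\<^sup>2 * (E * exp d + 1))) \<le> 2 * E / (E + 1)\<^sup>2 * norm (1::real)"
      by (simp only: real_norm_def abs_of_nonneg abs_one mult_1_right)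
  qed
  moreover have "(\<lambda>d. (E + 1) * (exp d - 1 - d) - E * (d * (exp d - 1))) \<in> O[at 0](\<lambda>d. d\<^sup>2)"
  proof (rule sum_in_bigo)
    have "(\<lambda>d::real. exp d - 1 - d) \<in> O[at 0](\<lambda>d. d\<^sup>2)" by real_asymp
    then show "(\<lambda>d. (E + 1) * (exp d - 1 - d)) \<in> O[at 0](\<lambda>d. d\<^sup>2)" using E by simp
    have "(\<lambda>d::real. d * (exp d - 1)) \<in> O[at 0](\<lambda>d. d\<^sup>2)" by real_asymp
    then show "(\<lambda>d. E * (d * (exp d - 1))) \<in> O[at 0](\<lambda>d. d\<^sup>2)" using E by simp
  qed
  ultimately have "(\<lambda>d. 2 * E / ((E + 1)\<^sup>2 * (E * exp d + 1)) *
      ((E + 1) * (exp d - 1 - d) - E * (d * (exp d - 1)))) \<in> O[at 0](\<lambda>d. 1 * d\<^sup>2)"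
    by (rule landau_o.big.mult)
  \<comment> \<open>The remainder factors into a bounded quotient and a combination of
    \<open>exp d - 1 - d\<close> and \<open>d * (exp d - 1)\<close>, both of second order.\<close>
  moreover have "2 * E / ((E + 1)\<^sup>2 * (E * w + 1)) * ((E + 1) * (w - 1 - d) - E * (d * (w - 1)))
      = (E * w - 1) / (E * w + 1) - (E - 1) / (E + 1) - 2 * E / (E + 1)\<^sup>2 * d" if "0 < w" for w d
  proof -
    have "E * w + 1 \<noteq> 0" "E + 1 \<noteq> 0" using E that by (auto simp: add_nonneg_eq_0_iff)
    then show ?thesis by (simp add: divide_simps power2_eq_square) (simp add: algebra_simps)
  qed
  ultimately have "?f \<in> O[at 0](\<lambda>d. d\<^sup>2)" by simp
  then obtain c where "0 < c" "\<forall>\<^sub>F d in at 0. norm (?f d) \<le> c * norm (d\<^sup>2)"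
    by (elim landau_o.bigE)
  moreover have "?f 0 = 0" by simp
  ultimately show ?thesis
    by (intro landau_o.bigI[of c]) (simp_all add: eventually_nhds_conv_at)
qed

text \<open>Writing the square root as an exponential of logarithms separates the contributions of
  the two slopes, leaving one constant for the half turn.\<close>

lemma transit_log_ratio:
  assumes "\<bar>\<sigma>\<bar> = 1"
  shows "transit_time \<sigma> \<rho> l = pi / om + (phiT \<sigma> \<rho> - phiT \<sigma> l)"
    and "transit_ratio \<sigma> \<rho> l = exp (- (\<sigma> * pi / (2 * om)) + (phiR \<sigma> \<rho> - phiR \<sigma> l))"
proof -
  show T: "transit_time \<sigma> \<rho> l = pi / om + (phiT \<sigma> \<rho> - phiT \<sigma> l)"
    unfolding transit_time_def phiT_def by (simp add: add_divide_distrib diff_divide_distrib)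
  let ?Q = "\<lambda>x. 1 + \<sigma> * x + x\<^sup>2"
  have Q: "0 < ?Q x" for x by (rule quad_pos[OF assms])
  have "sqrt (?Q \<rho> / ?Q l) = exp (ln (?Q \<rho> / ?Q l) / 2)"
    using Q[of \<rho>] Q[of l] by (subst powr_half_sqrt[symmetric]) (simp_all add: powr_def)
  also have "ln (?Q \<rho> / ?Q l) = ln (?Q \<rho>) - ln (?Q l)"
    using Q[of \<rho>] Q[of l] by (simp add: ln_div)
  finally have "transit_ratio \<sigma> \<rho> l = exp (- (\<sigma> * transit_time \<sigma> \<rho> l / 2)) * exp ((ln (?Q \<rho>) - ln (?Q l)) / 2)"
    unfolding transit_ratio_def by simp
  also have "\<dots> = exp (- (\<sigma> * transit_time \<sigma> \<rho> l / 2) + (ln (?Q \<rho>) - ln (?Q l)) / 2)"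
    by (rule exp_add[symmetric])
  also have "- (\<sigma> * transit_time \<sigma> \<rho> l / 2) + (ln (?Q \<rho>) - ln (?Q l)) / 2
      = - (\<sigma> * pi / (2 * om)) + (phiR \<sigma> \<rho> - phiR \<sigma> l)"
    unfolding T phiR_def by (simp add: field_simps)
  finally show "transit_ratio \<sigma> \<rho> l = exp (- (\<sigma> * pi / (2 * om)) + (phiR \<sigma> \<rho> - phiR \<sigma> l))" .
qed

text \<open>Up to \<open>s ^ 3\<close> the slopes are \<open>- s\<close> and \<open>s / k\<close>.
  Inserted into the expansions of \<open>phiT\<close> and \<open>phiR\<close>, they give the stated
  polynomials; each error is itself of order \<open>s ^ 3\<close>.\<close>

lemma transit_expansion:
  assumes sigma: "\<bar>\<sigma>\<bar> = 1" and k: "0 < k"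
  defines "\<rho> \<equiv> \<lambda>s. lambda_R (s\<^sup>2) / s" and "l \<equiv> \<lambda>s. lambda_L k (s\<^sup>2) / s"
  shows "(\<lambda>s. phiT \<sigma> (\<rho> s) - phiT \<sigma> (l s) + (1 + k) / k * s + \<sigma> / 2 * (1 - 1 / k\<^sup>2) * s\<^sup>2)
      \<in> O[at_right 0](\<lambda>s. s ^ 3)"
    and "(\<lambda>s. phiR \<sigma> (\<rho> s) - phiR \<sigma> (l s) - (1 - 1 / k\<^sup>2) / 2 * s\<^sup>2) \<in> O[at_right 0](\<lambda>s. s ^ 3)"
proof -
  have R: "filterlim \<rho> (at 0) (at_right 0)" "\<rho> \<in> O[at_right 0](\<lambda>s. s)"
    "(\<lambda>s. \<rho> s + s) \<in> O[at_right 0](\<lambda>s. s ^ 3)"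
    "(\<lambda>s. (\<rho> s)\<^sup>2 - s\<^sup>2) \<in> O[at_right 0](\<lambda>s. s ^ 3)"
    unfolding \<rho>_def by (rule slope_R_expansion)+
  have L: "filterlim l (at 0) (at_right 0)" "l \<in> O[at_right 0](\<lambda>s. s)"
    "(\<lambda>s. l s - s / k) \<in> O[at_right 0](\<lambda>s. s ^ 3)"
    "(\<lambda>s. (l s)\<^sup>2 - s\<^sup>2 / k\<^sup>2) \<in> O[at_right 0](\<lambda>s. s ^ 3)"
    unfolding l_def by (rule slope_L_expansion[OF k])+
  have comp: "(\<lambda>s. f (g s)) \<in> O[at_right 0](\<lambda>s. s ^ 3)"
    if "f \<in> O[at 0](\<lambda>x. x ^ 3)" "filterlim g (at 0) (at_right 0)" "g \<in> O[at_right 0](\<lambda>s. s)"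
    for f g :: "real \<Rightarrow> real"
    using landau_o.big.compose[OF that(1,2)] landau_o.big_power[OF that(3), of 3]
    by (rule landau_o.big_trans)
  have scale: "(\<lambda>s. c * f s) \<in> O[at_right 0](\<lambda>s. s ^ 3)" if "f \<in> O[at_right 0](\<lambda>s. s ^ 3)"
    for c :: real and f :: "real \<Rightarrow> real"
    using that by (cases "c = 0") simp_all
  note T = comp[OF phiT_expansion[OF sigma] R(1,2)] comp[OF phiT_expansion[OF sigma] L(1,2)]
  have "(\<lambda>s. (phiT \<sigma> (\<rho> s) - phiT \<sigma> 0 - (\<rho> s - \<sigma> * (\<rho> s)\<^sup>2 / 2))
      - (phiT \<sigma> (l s) - phiT \<sigma> 0 - (l s - \<sigma> * (l s)\<^sup>2 / 2))
      + ((\<rho> s + s) - (l s - s / k) + - (\<sigma> / 2) * ((\<rho> s)\<^sup>2 - s\<^sup>2) + \<sigma> / 2 * ((l s)\<^sup>2 - s\<^sup>2 / k\<^sup>2)))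
      \<in> O[at_right 0](\<lambda>s. s ^ 3)"
    by (intro sum_in_bigo(1) sum_in_bigo(2)[OF T] sum_in_bigo(2)[OF R(3) L(3)] scale R(4) L(4))
  then show "(\<lambda>s. phiT \<sigma> (\<rho> s) - phiT \<sigma> (l s) + (1 + k) / k * s + \<sigma> / 2 * (1 - 1 / k\<^sup>2) * s\<^sup>2)
      \<in> O[at_right 0](\<lambda>s. s ^ 3)"
    by (rule back_subst[where P = "\<lambda>f. f \<in> _"]) (use k in \<open>simp add: fun_eq_iff field_simps\<close>)
  note P = comp[OF phiR_expansion[OF sigma] R(1,2)] comp[OF phiR_expansion[OF sigma] L(1,2)]
  have "(\<lambda>s. (phiR \<sigma> (\<rho> s) - phiR \<sigma> 0 - (\<rho> s)\<^sup>2 / 2) - (phiR \<sigma> (l s) - phiR \<sigma> 0 - (l s)\<^sup>2 / 2)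
      + (1/2 * ((\<rho> s)\<^sup>2 - s\<^sup>2) - 1/2 * ((l s)\<^sup>2 - s\<^sup>2 / k\<^sup>2)))
      \<in> O[at_right 0](\<lambda>s. s ^ 3)"
    by (intro sum_in_bigo(1) sum_in_bigo(2)[OF P] sum_in_bigo(2) scale R(4) L(4))
  then show "(\<lambda>s. phiR \<sigma> (\<rho> s) - phiR \<sigma> (l s) - (1 - 1 / k\<^sup>2) / 2 * s\<^sup>2) \<in> O[at_right 0](\<lambda>s. s ^ 3)"
    by (rule back_subst[where P = "\<lambda>f. f \<in> _"]) (use k in \<open>simp add: fun_eq_iff field_simps\<close>)
qed

section \<open>Expansions of the canard value and the flight time in sqrt epsilon\<close>

definition canard_value :: "real \<Rightarrow> real \<Rightarrow> real \<Rightarrow> real" where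
  "canard_value \<sigma> k s =
     (let R = transit_ratio \<sigma> (lambda_R (s\<^sup>2) / s) (lambda_L k (s\<^sup>2) / s) in s * (R - 1) / (R + 1))"

definition canard_time :: "real \<Rightarrow> real \<Rightarrow> real \<Rightarrow> real" where
  "canard_time \<sigma> k s = transit_time \<sigma> (lambda_R (s\<^sup>2) / s) (lambda_L k (s\<^sup>2) / s) / s"

lemma pi_div_om: "pi / om = 2 * pi / sqrt 3"
  by (simp add: om_def)

lemma canard_time_expansion:
  assumes "\<bar>\<sigma>\<bar> = 1" "0 < k"
  shows "(\<lambda>s. canard_time \<sigma> k s -
      (2 * pi / sqrt 3 * (1 / s) - (1 + k) / k + \<sigma> * ((1 - k\<^sup>2) / (2 * k\<^sup>2)) * s)) \<in> O[at_right 0](\<lambda>s. s\<^sup>2)"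
proof -
  let ?r = "\<lambda>s. phiT \<sigma> (lambda_R (s\<^sup>2) / s) - phiT \<sigma> (lambda_L k (s\<^sup>2) / s) + (1 + k) / k * s
    + \<sigma> / 2 * (1 - 1 / k\<^sup>2) * s\<^sup>2"
  have "(\<lambda>s. ?r s * inverse s) \<in> O[at_right 0](\<lambda>s. s ^ 3 * inverse s)"
    by (intro landau_o.big.mult transit_expansion(1) assms landau_o.big_refl)
  also have "(\<lambda>s. s ^ 3 * inverse s) \<in> \<Theta>[at_right 0](\<lambda>s. s\<^sup>2 :: real)"
    by real_asymp
  also have "(\<lambda>s. ?r s * inverse s) \<in> O[at_right 0](\<lambda>s. s\<^sup>2) \<longleftrightarrow> ?thesis"
  proof (rule landau_o.big.in_cong)
    show "\<forall>\<^sub>F s in at_right 0. ?r s * inverse s = canard_time \<sigma> k s -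
      (2 * pi / sqrt 3 * (1 / s) - (1 + k) / k + \<sigma> * ((1 - k\<^sup>2) / (2 * k\<^sup>2)) * s)"
      using eventually_at_right_less[of 0]
    proof eventually_elim
      case (elim s)
      have "(d + (1 + k) / k * s + \<sigma> / 2 * (1 - 1 / k\<^sup>2) * s\<^sup>2) * inverse s =
          (c + d) / s - (c * (1 / s) - (1 + k) / k + \<sigma> * ((1 - k\<^sup>2) / (2 * k\<^sup>2)) * s)" for c d
        using elim assms(2) by (simp add: field_simps power2_eq_square)
      then show ?case
        unfolding canard_time_def transit_log_ratio(1)[OF assms(1)] pi_div_om .
    qed
  qed
  finally show ?thesis .
qed

text \<open>The logarithm of the contraction ratio is a constant plus
  \<open>\<delta> s = c * s\<^sup>2 + O(s ^ 3)\<close>. The first-order formula for the quotient has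
  error of order \<open>s ^ 3\<close>, and the prefactor \<open>s\<close> raises it to
  \<open>s ^ 4\<close>.\<close>

lemma canard_value_expansion:
  assumes sigma: "\<bar>\<sigma>\<bar> = 1" and k: "0 < k"
  defines "E \<equiv> exp (pi / sqrt 3)"
  shows "(\<lambda>s. canard_value \<sigma> k s -
      (- \<sigma> * ((E - 1) / (E + 1)) * s - E / (E + 1)\<^sup>2 * ((1 - k\<^sup>2) / k\<^sup>2) * s ^ 3)) \<in> O[at_right 0](\<lambda>s. s ^ 4)"
proof -
  define F where "F = exp (- (\<sigma> * pi / sqrt 3))"
  define \<delta> where "\<delta> s = phiR \<sigma> (lambda_R (s\<^sup>2) / s) - phiR \<sigma> (lambda_L k (s\<^sup>2) / s)" for s
  define c where "c = (1 - 1 / k\<^sup>2) / 2"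
  have E: "0 < E" and F: "0 < F" by (simp_all add: E_def F_def)
  have pe: "- (\<sigma> * pi / (2 * om)) = - (\<sigma> * pi / sqrt 3)" by (simp add: om_def)
  have R: "canard_value \<sigma> k s = s * ((F * exp (\<delta> s) - 1) / (F * exp (\<delta> s) + 1))" for s
    unfolding canard_value_def Let_def transit_log_ratio(2)[OF sigma] F_def \<delta>_def pe exp_add
    by simp
  \<comment> \<open>\<open>F\<close> is \<open>E\<close> or its inverse according to the sign of
    \<open>\<sigma>\<close>. Inversion flips the sign of the first quotient and fixes the second, so
    only the leading coefficient depends on \<open>\<sigma>\<close>.\<close>
  have H: "(F - 1) / (F + 1) = - \<sigma> * ((E - 1) / (E + 1)) \<and> 2 * F / (F + 1)\<^sup>2 = 2 * E / (E + 1)\<^sup>2"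
  proof -
    have i: "(inverse E - 1) / (inverse E + 1) = - ((E - 1) / (E + 1))"
      "2 * inverse E / (inverse E + 1)\<^sup>2 = 2 * E / (E + 1)\<^sup>2"
      using E by (simp_all add: divide_simps power2_eq_square) (simp_all add: algebra_simps)
    consider "\<sigma> = 1" "F = inverse E" | "\<sigma> = - 1" "F = E"
      using sigma by (auto simp: F_def E_def exp_minus abs_if split: if_splits)
    then show ?thesis by cases (simp_all only: i mult_minus_left mult_1_left minus_minus simp_thms)
  qed
  note H = conjunct1[OF H] conjunct2[OF H]
  have d3: "(\<lambda>s. \<delta> s - c * s\<^sup>2) \<in> O[at_right 0](\<lambda>s. s ^ 3)"
    unfolding \<delta>_def c_def by (rule transit_expansion(2)[OF sigma k])
  have "(\<lambda>s. s ^ 3 :: real) \<in> O[at_right 0](\<lambda>s. s\<^sup>2)" by real_asymp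
  then have "(\<lambda>s. \<delta> s - c * s\<^sup>2) \<in> O[at_right 0](\<lambda>s. s\<^sup>2)" by (rule landau_o.big_trans[OF d3])
  \<comment> \<open>The case \<open>c = 0\<close> occurs for \<open>k = 1\<close>.\<close>
  moreover have "(\<lambda>s. c * s\<^sup>2) \<in> O[at_right 0](\<lambda>s. s\<^sup>2)" by (cases "c = 0") simp_all
  ultimately have "(\<lambda>s. \<delta> s - c * s\<^sup>2 + c * s\<^sup>2) \<in> O[at_right 0](\<lambda>s. s\<^sup>2)" by (rule sum_in_bigo)
  then have d2: "\<delta> \<in> O[at_right 0](\<lambda>s. s\<^sup>2)" by simp
  moreover have "(\<lambda>s. s\<^sup>2 :: real) \<in> o[at_right 0](\<lambda>_. 1)" by real_asymp
  ultimately have "\<delta> \<in> o[at_right 0](\<lambda>_. 1)" by (rule landau_o.big_small_trans)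
  then have lim: "filterlim \<delta> (nhds 0) (at_right 0)" using smalloD_tendsto by fastforce
  have "(\<lambda>s. (\<delta> s)\<^sup>2) \<in> O[at_right 0](\<lambda>s. (s\<^sup>2)\<^sup>2)" by (rule landau_o.big_power[OF d2])
  also have "(\<lambda>s. (s\<^sup>2)\<^sup>2 :: real) \<in> O[at_right 0](\<lambda>s. s ^ 3)" by real_asymp
  finally have "(\<lambda>s. (F * exp (\<delta> s) - 1) / (F * exp (\<delta> s) + 1) - (F - 1) / (F + 1) - 2 * F / (F + 1)\<^sup>2 * \<delta> s)
      \<in> O[at_right 0](\<lambda>s. s ^ 3)"
    by (rule landau_o.big_trans[OF landau_o.big.compose[OF mobius_exp_expansion[OF F] lim]])
  moreover have "(\<lambda>s. 2 * F / (F + 1)\<^sup>2 * (\<delta> s - c * s\<^sup>2)) \<in> O[at_right 0](\<lambda>s. s ^ 3)"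
    using d3 F by simp
  ultimately have "(\<lambda>s. (F * exp (\<delta> s) - 1) / (F * exp (\<delta> s) + 1) - (F - 1) / (F + 1) - 2 * F / (F + 1)\<^sup>2 * \<delta> s
      + 2 * F / (F + 1)\<^sup>2 * (\<delta> s - c * s\<^sup>2)) \<in> O[at_right 0](\<lambda>s. s ^ 3)"
    by (rule sum_in_bigo)
  then have "(\<lambda>s. s * ((F * exp (\<delta> s) - 1) / (F * exp (\<delta> s) + 1) - (F - 1) / (F + 1) - 2 * F / (F + 1)\<^sup>2 * \<delta> s
      + 2 * F / (F + 1)\<^sup>2 * (\<delta> s - c * s\<^sup>2))) \<in> O[at_right 0](\<lambda>s. s * s ^ 3)"
    by (intro landau_o.big.mult landau_o.big_refl)
  then have "(\<lambda>s. s * ((F * exp (\<delta> s) - 1) / (F * exp (\<delta> s) + 1) - (F - 1) / (F + 1) - 2 * F / (F + 1)\<^sup>2 * \<delta> s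
      + 2 * F / (F + 1)\<^sup>2 * (\<delta> s - c * s\<^sup>2))) \<in> O[at_right 0](\<lambda>s. s ^ 4)"
    by (simp add: power_numeral_reduce)
  also have "(\<lambda>s. s * ((F * exp (\<delta> s) - 1) / (F * exp (\<delta> s) + 1) - (F - 1) / (F + 1) - 2 * F / (F + 1)\<^sup>2 * \<delta> s
      + 2 * F / (F + 1)\<^sup>2 * (\<delta> s - c * s\<^sup>2))) = (\<lambda>s. canard_value \<sigma> k s -
      (- \<sigma> * ((E - 1) / (E + 1)) * s - E / (E + 1)\<^sup>2 * ((1 - k\<^sup>2) / k\<^sup>2) * s ^ 3))"
  proof
    fix s
    have "2 * F / (F + 1)\<^sup>2 * c = - (E / (E + 1)\<^sup>2 * ((1 - k\<^sup>2) / k\<^sup>2))"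
    proof -
      have "g * c = - (E / (E + 1)\<^sup>2 * ((1 - k\<^sup>2) / k\<^sup>2))" if "g = 2 * (E / (E + 1)\<^sup>2)" for g
      proof -
        have "2 * x * c = - (x * ((1 - k\<^sup>2) / k\<^sup>2))" for x
          unfolding c_def using k by (simp add: field_simps)
        then show ?thesis unfolding that .
      qed
      then show ?thesis unfolding H by simp
    qed
    moreover have "s * (w - h - g * d + g * (d - c * s\<^sup>2)) = s * w - (h * s + (g * c) * s ^ 3)" for w h g d
      by (simp add: algebra_simps power_numeral_reduce)
    ultimately show "s * ((F * exp (\<delta> s) - 1) / (F * exp (\<delta> s) + 1) - (F - 1) / (F + 1) - 2 * F / (F + 1)\<^sup>2 * \<delta> s
      + 2 * F / (F + 1)\<^sup>2 * (\<delta> s - c * s\<^sup>2)) = canard_value \<sigma> k s -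
      (- \<sigma> * ((E - 1) / (E + 1)) * s - E / (E + 1)\<^sup>2 * ((1 - k\<^sup>2) / k\<^sup>2) * s ^ 3)"
      unfolding R by (simp only: H(1)) simp
  qed
  finally show ?thesis .
qed

section \<open>The maximal canard\<close>

text \<open>The assumptions keep the radicands of the eigenvalues positive and the divisor
  \<open>s\<close> nonzero; positivity of the quadratics and nonnegativity of the ratio take care of
  the remaining root and denominators.\<close>

lemma ranalytic2_at_canard_value:
  assumes sigma: "\<bar>\<sigma>\<bar> = 1" and z: "0 < snd z" "4 * (snd z)\<^sup>2 < 1" "4 * (snd z)\<^sup>2 < (fst z)\<^sup>2"
  shows "ranalytic2_at (\<lambda>p. canard_value \<sigma> (fst p) (snd p)) z"
proof -
  define \<rho> where "\<rho> p = lambda_R ((snd p)\<^sup>2) / snd p" for p :: "real \<times> real"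
  define l where "l p = lambda_L (fst p) ((snd p)\<^sup>2) / snd p" for p :: "real \<times> real"
  have \<rho>: "ranalytic2_at \<rho> z"
    unfolding \<rho>_def[abs_def] lambda_R_def by (intro ranalytic2_intros) (use z in auto)
  have l: "ranalytic2_at l z"
    unfolding l_def[abs_def] lambda_L_def by (intro ranalytic2_intros) (use z in auto)
  have T: "ranalytic2_at (\<lambda>p. transit_time \<sigma> (\<rho> p) (l p)) z"
    unfolding transit_time_def by (intro ranalytic2_intros \<rho> l) auto
  have "0 < (1 + \<sigma> * \<rho> z + (\<rho> z)\<^sup>2) / (1 + \<sigma> * l z + (l z)\<^sup>2)"
    using quad_pos[OF sigma] by simp
  moreover have "1 + \<sigma> * l z + (l z)\<^sup>2 \<noteq> 0" using quad_pos[OF sigma, of "l z"] by simp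
  ultimately have R: "ranalytic2_at (\<lambda>p. transit_ratio \<sigma> (\<rho> p) (l p)) z"
    unfolding transit_ratio_def by (intro ranalytic2_intros \<rho> l T) auto
  have "0 \<le> transit_ratio \<sigma> (\<rho> z) (l z)"
    unfolding transit_ratio_def using quad_pos[OF sigma] by (simp add: less_imp_le)
  then have "ranalytic2_at (\<lambda>p. snd p * (transit_ratio \<sigma> (\<rho> p) (l p) - 1) / (transit_ratio \<sigma> (\<rho> p) (l p) + 1)) z"
    by (intro ranalytic2_intros R) auto
  then show ?thesis unfolding canard_value_def Let_def \<rho>_def l_def .
qed

lemma connects_from_iff:
  assumes "\<bar>\<sigma>\<bar> = 1" "0 < s" "s < 1/2" "2 * s < k" and p: "p \<in> mu_R a (\<sigma> * s) (s\<^sup>2)"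
  shows "connects_from a k (\<sigma> * s) (s\<^sup>2) p \<tau> \<longleftrightarrow> a = canard_value \<sigma> k s \<and> \<tau> = canard_time \<sigma> k s"
proof -
  interpret canard \<sigma> s k using assms by unfold_locales
  show ?thesis
    using connects_from_imp[of a p \<tau>] connects_from_canard[OF _ p]
    unfolding canard_value_def canard_time_def Let_def by blast
qed

lemma canard_time_pos:
  assumes "\<bar>\<sigma>\<bar> = 1" "0 < s" "s < 1/2" "2 * s < k"
  shows "0 < canard_time \<sigma> k s"
proof -
  interpret canard \<sigma> s k using assms by unfold_locales
  show ?thesis using Tc_bounds s unfolding canard_time_def by simp
qed

lemma bigo_sqrt:
  fixes f :: "real \<Rightarrow> real"
  assumes "f \<in> O[at_right 0](\<lambda>s. s ^ (2 * n))"
  shows "(\<lambda>\<epsilon>. f (sqrt \<epsilon>)) \<in> O[at_right 0](\<lambda>\<epsilon>. \<epsilon> ^ n)"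
proof -
  have "filterlim sqrt (at_right 0) (at_right 0)" by real_asymp
  from landau_o.big.compose[OF assms this]
  have "(\<lambda>\<epsilon>. f (sqrt \<epsilon>)) \<in> O[at_right 0](\<lambda>\<epsilon>. sqrt \<epsilon> ^ (2 * n))" .
  also have "O[at_right 0](\<lambda>\<epsilon>. sqrt \<epsilon> ^ (2 * n)) = O[at_right 0](\<lambda>\<epsilon>. \<epsilon> ^ n)"
  proof (rule landau_o.big.cong)
    show "\<forall>\<^sub>F \<epsilon> in at_right 0. sqrt \<epsilon> ^ (2 * n) = \<epsilon> ^ n"
      using eventually_at_right_less[of 0] by eventually_elim (simp add: power_mult)
  qed
  finally show ?thesis .
qed

theorem theorem4p2:
  shows "\<exists>\<epsilon>0 > 0. \<exists>(a' :: real \<Rightarrow> real \<Rightarrow> real \<Rightarrow> real) (\<tau>C :: real \<Rightarrow> real \<Rightarrow> real \<Rightarrow> real).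
    (\<forall>\<sigma>\<in>{-1, 1}.
       real_analytic2_on (\<lambda>(k, s). a' k (s\<^sup>2) (\<sigma> * s))
         {(k, s). 0 < s \<and> (k, s\<^sup>2) \<in> param_dom \<epsilon>0} \<and>
       (\<forall>(k, \<epsilon>) \<in> param_dom \<epsilon>0.
          let m = \<sigma> * sqrt \<epsilon> in
          (\<forall>a. \<forall>p \<in> mu_R a m \<epsilon>.
             (\<exists>\<tau>. connects_from a k m \<epsilon> p \<tau>) \<longleftrightarrow> a = a' k \<epsilon> m) \<and>
          0 < \<tau>C k \<epsilon> m \<and>
          (\<forall>p \<in> mu_R (a' k \<epsilon> m) m \<epsilon>. \<forall>\<tau>.
             connects_from (a' k \<epsilon> m) k m \<epsilon> p \<tau> \<longleftrightarrow> \<tau> = \<tau>C k \<epsilon> m))) \<and>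
    (let E = exp (pi / sqrt 3) in
     \<forall>k > 0.
       (\<lambda>\<epsilon>. a' k \<epsilon> (- sqrt \<epsilon>) -
             ((E - 1) / (E + 1) * sqrt \<epsilon>
              - E / (E + 1)\<^sup>2 * ((1 - k\<^sup>2) / k\<^sup>2) * \<epsilon> powr (3 / 2)))
          \<in> O[at_right 0](\<lambda>\<epsilon>. \<epsilon>\<^sup>2) \<and>
       (\<lambda>\<epsilon>. a' k \<epsilon> (sqrt \<epsilon>) -
             (- ((E - 1) / (E + 1)) * sqrt \<epsilon>
              - E / (E + 1)\<^sup>2 * ((1 - k\<^sup>2) / k\<^sup>2) * \<epsilon> powr (3 / 2)))
          \<in> O[at_right 0](\<lambda>\<epsilon>. \<epsilon>\<^sup>2) \<and>
       (\<lambda>\<epsilon>. \<tau>C k \<epsilon> (- sqrt \<epsilon>) -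
             (2 * pi / sqrt 3 * (1 / sqrt \<epsilon>) - (1 + k) / k
              - (1 - k\<^sup>2) / (2 * k\<^sup>2) * sqrt \<epsilon>))
          \<in> O[at_right 0](\<lambda>\<epsilon>. \<epsilon>) \<and>
       (\<lambda>\<epsilon>. \<tau>C k \<epsilon> (sqrt \<epsilon>) -
             (2 * pi / sqrt 3 * (1 / sqrt \<epsilon>) - (1 + k) / k
              + (1 - k\<^sup>2) / (2 * k\<^sup>2) * sqrt \<epsilon>))
          \<in> O[at_right 0](\<lambda>\<epsilon>. \<epsilon>))"
proof -
  \<comment> \<open>For \<open>\<epsilon> > 0\<close> the sign of \<open>m\<close> recovers
    \<open>\<sigma>\<close> from \<open>m = \<sigma> * sqrt \<epsilon>\<close>.\<close>
  define a' where "a' k \<epsilon> m = canard_value (sgn m) k (sqrt \<epsilon>)" for k \<epsilon> m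
  define \<tau>C where "\<tau>C k \<epsilon> m = canard_time (sgn m) k (sqrt \<epsilon>)" for k \<epsilon> m
  have sgn: "sgn (\<sigma> * s) = \<sigma>" if "\<sigma> \<in> {-1, 1}" "0 < s" for \<sigma> s :: real
    using that by auto
  have analytic: "real_analytic2_on (\<lambda>(k, s). a' k (s\<^sup>2) (\<sigma> * s)) {(k, s). 0 < s \<and> (k, s\<^sup>2) \<in> param_dom (1/4)}"
    if \<sigma>: "\<sigma> \<in> {-1, 1}" for \<sigma>
  proof (rule real_analytic2_onI, rule ranalytic2_at_cong)
    fix z :: "real \<times> real" assume "z \<in> {(k, s). 0 < s \<and> (k, s\<^sup>2) \<in> param_dom (1/4)}"
    then have z: "0 < snd z" "4 * (snd z)\<^sup>2 < 1" "4 * (snd z)\<^sup>2 < (fst z)\<^sup>2"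
      by (auto simp: param_dom_def)
    show "ranalytic2_at (\<lambda>p. canard_value \<sigma> (fst p) (snd p)) z"
      using \<sigma> by (intro ranalytic2_at_canard_value z) auto
    \<comment> \<open>The identities \<open>sqrt (s\<^sup>2) = s\<close> and
      \<open>sgn (\<sigma> * s) = \<sigma>\<close> hold for \<open>s > 0\<close>, hence on a whole
      neighbourhood of \<open>z\<close>.\<close>
    have "open {p :: real \<times> real. 0 < snd p}" by (intro open_Collect_less continuous_intros)
    then have "\<forall>\<^sub>F p in nhds z. 0 < snd p" using z(1) eventually_nhds by blast
    then show "\<forall>\<^sub>F p in nhds z. canard_value \<sigma> (fst p) (snd p) = (case p of (k, s) \<Rightarrow> a' k (s\<^sup>2) (\<sigma> * s))"
      by eventually_elim (use sgn[OF \<sigma>] in \<open>auto simp: a'_def\<close>)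
  qed
  have conn: "(\<forall>a. \<forall>p \<in> mu_R a m \<epsilon>. (\<exists>\<tau>. connects_from a k m \<epsilon> p \<tau>) \<longleftrightarrow> a = a' k \<epsilon> m) \<and>
      0 < \<tau>C k \<epsilon> m \<and>
      (\<forall>p \<in> mu_R (a' k \<epsilon> m) m \<epsilon>. \<forall>\<tau>. connects_from (a' k \<epsilon> m) k m \<epsilon> p \<tau> \<longleftrightarrow> \<tau> = \<tau>C k \<epsilon> m)"
    if \<sigma>: "\<sigma> \<in> {-1, 1}" and k\<epsilon>: "(k, \<epsilon>) \<in> param_dom (1/4)" and m: "m = \<sigma> * sqrt \<epsilon>" for \<sigma> k \<epsilon> m
  proof -
    define s where "s = sqrt \<epsilon>"
    have *: "0 < k" "0 < \<epsilon>" "\<epsilon> < 1/4" "4 * \<epsilon> < k\<^sup>2" using k\<epsilon> by (auto simp: param_dom_def)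
    then have \<epsilon>: "\<epsilon> = s\<^sup>2" and s: "0 < s" by (simp_all add: s_def)
    have s2: "s < 1/2"
      using *(3) power2_less_imp_less[of s "1/2"] unfolding \<epsilon> by (simp add: power_divide)
    have sk: "2 * s < k"
      using *(1,4) power2_less_imp_less[of "2 * s" k] unfolding \<epsilon> by (simp add: power_mult_distrib)
    have abs: "\<bar>\<sigma>\<bar> = 1" using \<sigma> by auto
    have m: "m = \<sigma> * s" and a: "a' k \<epsilon> m = canard_value \<sigma> k s" and t: "\<tau>C k \<epsilon> m = canard_time \<sigma> k s"
      using sgn[OF \<sigma> s] m unfolding a'_def \<tau>C_def s_def by simp_all
    show ?thesis
      unfolding a t using connects_from_iff[OF abs s s2 sk] canard_time_pos[OF abs s s2 sk]
      unfolding m \<epsilon> by blast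
  qed
  have pw: "\<forall>\<^sub>F \<epsilon> in at_right 0. 0 < \<epsilon> \<and> \<epsilon> powr (3 / 2) = sqrt \<epsilon> ^ 3"
    using eventually_at_right_less[of 0]
  proof eventually_elim
    case (elim \<epsilon>)
    then show ?case by (simp add: powr_half_sqrt[symmetric] powr_power)
  qed
  have val: "(\<lambda>\<epsilon>. a' k \<epsilon> (\<sigma> * sqrt \<epsilon>) - (- \<sigma> * ((E - 1) / (E + 1)) * sqrt \<epsilon>
      - E / (E + 1)\<^sup>2 * ((1 - k\<^sup>2) / k\<^sup>2) * \<epsilon> powr (3 / 2))) \<in> O[at_right 0](\<lambda>\<epsilon>. \<epsilon>\<^sup>2)"
    if "0 < k" "\<sigma> \<in> {-1, 1}" "E = exp (pi / sqrt 3)" for k \<sigma> E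
  proof -
    have "(\<lambda>s. canard_value \<sigma> k s - (- \<sigma> * ((E - 1) / (E + 1)) * s - E / (E + 1)\<^sup>2 * ((1 - k\<^sup>2) / k\<^sup>2) * s ^ 3))
        \<in> O[at_right 0](\<lambda>s. s ^ (2 * 2))"
      using canard_value_expansion[of \<sigma> k] that by auto
    from bigo_sqrt[OF this]
    have "(\<lambda>\<epsilon>. canard_value \<sigma> k (sqrt \<epsilon>) - (- \<sigma> * ((E - 1) / (E + 1)) * sqrt \<epsilon>
        - E / (E + 1)\<^sup>2 * ((1 - k\<^sup>2) / k\<^sup>2) * sqrt \<epsilon> ^ 3)) \<in> O[at_right 0](\<lambda>\<epsilon>. \<epsilon>\<^sup>2)" .
    also have "?this \<longleftrightarrow> ?thesis"
      by (rule landau_o.big.in_cong) (use pw in eventually_elim, use sgn[OF that(2)] in \<open>simp add: a'_def\<close>)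
    finally show ?thesis .
  qed
  have time: "(\<lambda>\<epsilon>. \<tau>C k \<epsilon> (\<sigma> * sqrt \<epsilon>) - (2 * pi / sqrt 3 * (1 / sqrt \<epsilon>) - (1 + k) / k
      + \<sigma> * ((1 - k\<^sup>2) / (2 * k\<^sup>2)) * sqrt \<epsilon>)) \<in> O[at_right 0](\<lambda>\<epsilon>. \<epsilon>)"
    if "0 < k" "\<sigma> \<in> {-1, 1}" for k \<sigma>
  proof -
    have "(\<lambda>s. canard_time \<sigma> k s - (2 * pi / sqrt 3 * (1 / s) - (1 + k) / k
        + \<sigma> * ((1 - k\<^sup>2) / (2 * k\<^sup>2)) * s)) \<in> O[at_right 0](\<lambda>s. s ^ (2 * 1))"
      using canard_time_expansion[of \<sigma> k] that by auto
    from bigo_sqrt[OF this]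
    have "(\<lambda>\<epsilon>. canard_time \<sigma> k (sqrt \<epsilon>) - (2 * pi / sqrt 3 * (1 / sqrt \<epsilon>) - (1 + k) / k
        + \<sigma> * ((1 - k\<^sup>2) / (2 * k\<^sup>2)) * sqrt \<epsilon>)) \<in> O[at_right 0](\<lambda>\<epsilon>. \<epsilon>)"
      unfolding power_one_right .
    also have "?this \<longleftrightarrow> ?thesis"
      by (rule landau_o.big.in_cong) (use pw in eventually_elim, use sgn[OF that(2)] in \<open>simp add: \<tau>C_def\<close>)
    finally show ?thesis .
  qed
  show ?thesis
    unfolding Let_def
  \<comment> \<open>\<open>\<epsilon> = 1/4\<close> is where the eigenvalues of the right zone cease
    to be real and distinct.\<close>
  proof (rule exI[of _ "1/4"], rule conjI[rotated], rule exI[of _ a'], rule exI[of _ \<tau>C], rule conjI, intro ballI conjI)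
    fix \<sigma> :: real assume "\<sigma> \<in> {-1, 1}"
    then show "real_analytic2_on (\<lambda>(k, s). a' k (s\<^sup>2) (\<sigma> * s)) {(k, s). 0 < s \<and> (k, s\<^sup>2) \<in> param_dom (1/4)}"
      by (rule analytic)
  next
    fix \<sigma> :: real and x assume "\<sigma> \<in> {-1, 1}" "x \<in> param_dom (1/4)"
    then show "case x of (k, \<epsilon>) \<Rightarrow>
        (\<forall>a. \<forall>p \<in> mu_R a (\<sigma> * sqrt \<epsilon>) \<epsilon>.
          (\<exists>\<tau>. connects_from a k (\<sigma> * sqrt \<epsilon>) \<epsilon> p \<tau>) \<longleftrightarrow> a = a' k \<epsilon> (\<sigma> * sqrt \<epsilon>)) \<and>
        0 < \<tau>C k \<epsilon> (\<sigma> * sqrt \<epsilon>) \<and>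
        (\<forall>p \<in> mu_R (a' k \<epsilon> (\<sigma> * sqrt \<epsilon>)) (\<sigma> * sqrt \<epsilon>) \<epsilon>. \<forall>\<tau>.
          connects_from (a' k \<epsilon> (\<sigma> * sqrt \<epsilon>)) k (\<sigma> * sqrt \<epsilon>) \<epsilon> p \<tau> \<longleftrightarrow> \<tau> = \<tau>C k \<epsilon> (\<sigma> * sqrt \<epsilon>))"
      unfolding case_prod_unfold by (intro conn) auto
  next
    show "\<forall>k>0.
       (\<lambda>\<epsilon>. a' k \<epsilon> (- sqrt \<epsilon>) -
             ((exp (pi / sqrt 3) - 1) / (exp (pi / sqrt 3) + 1) * sqrt \<epsilon>
              - exp (pi / sqrt 3) / (exp (pi / sqrt 3) + 1)\<^sup>2 * ((1 - k\<^sup>2) / k\<^sup>2) * \<epsilon> powr (3 / 2)))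
          \<in> O[at_right 0](\<lambda>\<epsilon>. \<epsilon>\<^sup>2) \<and>
       (\<lambda>\<epsilon>. a' k \<epsilon> (sqrt \<epsilon>) -
             (- ((exp (pi / sqrt 3) - 1) / (exp (pi / sqrt 3) + 1)) * sqrt \<epsilon>
              - exp (pi / sqrt 3) / (exp (pi / sqrt 3) + 1)\<^sup>2 * ((1 - k\<^sup>2) / k\<^sup>2) * \<epsilon> powr (3 / 2)))
          \<in> O[at_right 0](\<lambda>\<epsilon>. \<epsilon>\<^sup>2) \<and>
       (\<lambda>\<epsilon>. \<tau>C k \<epsilon> (- sqrt \<epsilon>) -
             (2 * pi / sqrt 3 * (1 / sqrt \<epsilon>) - (1 + k) / k
              - (1 - k\<^sup>2) / (2 * k\<^sup>2) * sqrt \<epsilon>))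
          \<in> O[at_right 0](\<lambda>\<epsilon>. \<epsilon>) \<and>
       (\<lambda>\<epsilon>. \<tau>C k \<epsilon> (sqrt \<epsilon>) -
             (2 * pi / sqrt 3 * (1 / sqrt \<epsilon>) - (1 + k) / k
              + (1 - k\<^sup>2) / (2 * k\<^sup>2) * sqrt \<epsilon>))
          \<in> O[at_right 0](\<lambda>\<epsilon>. \<epsilon>)"
      using val[of _ "- 1", OF _ _ refl, unfolded mult_minus1 minus_minus mult_1_left]
        val[of _ 1, OF _ _ refl, unfolded mult_minus1 mult_1_left]
        time[of _ "- 1", unfolded mult_minus1 mult_1_left mult_minus_left add_uminus_conv_diff]
        time[of _ 1, unfolded mult_1_left] by blast
  qed simp
qed

end
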